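(* For every $m\geq 0$, $$\sum_{\lambda\in\mathcal P^+}\binom{\kappa(\lambda)}{m}q^{|\lambda|}=\frac{q^{2m^2}-q^{2(m+1)^2}}{(q;q)_\infty}.$$ Equivalently, for every $n,m\geq 0$, $$\sum_{\substack{\lambda\vdash n\\ \lambda\in\mathcal P^+}}\binom{\kappa(\lambda)}{m}=p(n-2m^2)-p\bigl(n-2(m+1)^2\bigr),$$ where $p(N)$ is the number of partitions of $N$ and $p(N)=0$ for $N<0$.
   Context: Let $\lambda$ be a partition with conjugate $\lambda'$ and Durfee size $d$ (the side of the largest square contained in the Young diagram of $\lambda$). Put $\alpha_i=\lambda_i-d$, $\beta_i=\lambda_i'-d$, $I_i=\min(\alpha_i,\beta_i)$ and $U_i=\max(\alpha_i,\beta_i)$ for $1\le i\le d$. The diagonal blocks of $\lambda$ are the edge-connected components of the skew diagram $U/I$ (cells adjacent when they share an edge), and $\kappa(\lambda)$ is their number. The successive ranks of $\lambda$ are $\sigma_i(\lambda)=\lambda_i-\lambda_i'$, $1\le i\le d$. $\mathcal P^+$ is the set of all partitions whose successive ranks are all nonnegative (including the empty partition). Also $(q;q)_\infty=\prod_{j\ge1}(1-q^j)$. *)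

theory Defs
  imports "HOL-Analysis.Infinite_Sum" "HOL-Analysis.Infinite_Products"
    "HOL-Computational_Algebra.Formal_Power_Series"
begin

text \<open>
  A partition is the weakly decreasing list of its positive parts.  Rows, columns and parts are
  numbered from 1, and parts beyond the length of the list are 0.
\<close>

definition is_partition :: "nat list \<Rightarrow> bool" where
  "is_partition l \<longleftrightarrow> sorted_wrt (\<ge>) l \<and> (\<forall>x\<in>set l. 0 < x)"

definition part :: "nat list \<Rightarrow> nat \<Rightarrow> nat" where
  "part l i = (if 1 \<le> i \<and> i \<le> length l then l ! (i - 1) else 0)"

definition young_diagram :: "nat list \<Rightarrow> (nat \<times> nat) set" where
  "young_diagram l = {(i, j). 1 \<le> i \<and> 1 \<le> j \<and> j \<le> part l i}"

definition conjugate :: "nat list \<Rightarrow> nat list" where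
  "conjugate l = map (\<lambda>j. card {i. (i, j) \<in> young_diagram l}) [1..<Suc (part l 1)]"

definition durfee :: "nat list \<Rightarrow> nat" where
  "durfee l = (GREATEST d. {1..d} \<times> {1..d} \<subseteq> young_diagram l)"

text \<open>
  For \<open>1 \<le> i \<le> durfee l\<close> the subtractions in \<open>alpha\<close> and \<open>beta\<close> do not truncate, since then
  both the \<open>i\<close>-th row and the \<open>i\<close>-th column have length at least \<open>durfee l\<close>.  The four sequences
  below are only used for these \<open>i\<close>.
\<close>

definition alpha :: "nat list \<Rightarrow> nat \<Rightarrow> nat" where
  "alpha l i = part l i - durfee l"

definition beta :: "nat list \<Rightarrow> nat \<Rightarrow> nat" where
  "beta l i = part (conjugate l) i - durfee l"

definition inner_part :: "nat list \<Rightarrow> nat \<Rightarrow> nat" where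
  "inner_part l i = min (alpha l i) (beta l i)"

definition outer_part :: "nat list \<Rightarrow> nat \<Rightarrow> nat" where
  "outer_part l i = max (alpha l i) (beta l i)"

text \<open>The cells of the skew diagram \<open>U/I\<close>.\<close>

definition skew_cells :: "nat list \<Rightarrow> (nat \<times> nat) set" where
  "skew_cells l = {(i, j). 1 \<le> i \<and> i \<le> durfee l \<and> inner_part l i < j \<and> j \<le> outer_part l i}"

definition edge_adjacent :: "nat \<times> nat \<Rightarrow> nat \<times> nat \<Rightarrow> bool" where
  "edge_adjacent c c' \<longleftrightarrow>
     (fst c = fst c' \<and> (snd c' = Suc (snd c) \<or> snd c = Suc (snd c'))) \<or>
     (snd c = snd c' \<and> (fst c' = Suc (fst c) \<or> fst c = Suc (fst c')))"

definition edge_components :: "(nat \<times> nat) set \<Rightarrow> (nat \<times> nat) set set" where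
  "edge_components S = S // ({(c, c'). c \<in> S \<and> c' \<in> S \<and> edge_adjacent c c'}\<^sup>*)"

definition diagonal_blocks :: "nat list \<Rightarrow> (nat \<times> nat) set set" where
  "diagonal_blocks l = edge_components (skew_cells l)"

definition kappa :: "nat list \<Rightarrow> nat" where
  "kappa l = card (diagonal_blocks l)"

definition successive_rank :: "nat list \<Rightarrow> nat \<Rightarrow> int" where
  "successive_rank l i = int (part l i) - int (part (conjugate l) i)"

definition P_plus :: "nat list set" where
  "P_plus = {l. is_partition l \<and> (\<forall>i. 1 \<le> i \<and> i \<le> durfee l \<longrightarrow> 0 \<le> successive_rank l i)}"

text \<open>The partition numbers are indexed by integers, with value 0 at negative arguments.\<close>

definition partition_number :: "int \<Rightarrow> nat" where
  "partition_number N = card {l. is_partition l \<and> int (sum_list l) = N}"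

text \<open>
  \<open>(q;q)\<^sub>\<infinity>\<close> as a formal power series in \<open>q\<close>; the infinite product is taken in the
  \<open>q\<close>-adic topology.
\<close>

definition q_pochhammer_inf :: "rat fps" where
  "q_pochhammer_inf = prodinf (\<lambda>j. 1 - fps_X ^ Suc j)"

lemma finite_partitions_of: "finite {l. is_partition l \<and> sum_list l = n}"
proof (rule finite_subset)
  show "{l. is_partition l \<and> sum_list l = n} \<subseteq> {l. set l \<subseteq> {..n} \<and> length l \<le> n}"
  proof (clarsimp, intro conjI)
    fix l :: "nat list" assume l: "is_partition l"
    show "set l \<subseteq> {..sum_list l}"
      by (auto intro: member_le_sum_list)
    have "(\<forall>x\<in>set l. 0 < x) \<Longrightarrow> length l \<le> sum_list l"
      by (induction l) auto
    with l show "length l \<le> sum_list l"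
      by (simp add: is_partition_def)
  qed
  show "finite {l. set l \<subseteq> {..n} \<and> length l \<le> n}"
    by (rule finite_lists_length_le) simp
qed

end

theory Submission
  imports Defs
begin

text \<open>
  Let \<open>b\<close> and \<open>a\<close> be the row and column lengths of a partition outside its Durfee rectangle with \<open>e\<close>
  rows and \<open>e + L\<close> columns, and call the pair nested when \<open>a (j + L) \<le> b j\<close> for all \<open>j\<close>.  For \<open>L = 0\<close> the
  nested pairs are the partitions in \<open>P_plus\<close>, and a block of \<open>U/I = b/a\<close> is determined by its first
  row \<open>j\<close>, where \<open>a j < b j \<le> a (j - 1)\<close>; so the left-hand side counts nested pairs with \<open>m\<close> marked
  first rows.  Deleting the first marked part from \<open>b\<close> and inserting it into \<open>a\<close>, with a shift by 1 of
  the parts before it, gives a nested pair for \<open>L + 2\<close> with one mark less, and the represented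
  partition loses \<open>2 * L + 2\<close> cells.  After \<open>m\<close> steps this leaves an unmarked nested pair for
  \<open>L = 2 * m\<close> and a loss of \<open>2 * m\<^sup>2\<close> cells.  At each level \<open>L\<close>, swapping tails at the first violation
  of nestedness (the Gessel--Viennot reflection) maps the non-nested pairs onto all pairs for
  \<open>L + 2\<close>, again with a loss of \<open>2 * L + 2\<close> cells, so there are \<open>p(N) - p(N - 2 * L - 2)\<close> nested pairs.
\<close>

section \<open>Nested pairs with marked rows\<close>

definition seqs :: "nat \<Rightarrow> (nat \<Rightarrow> nat) set" where
  "seqs n = {a. antimono a \<and> (\<forall>i\<ge>n. a i = 0)}"

type_synonym dissection = "nat \<times> (nat \<Rightarrow> nat) \<times> (nat \<Rightarrow> nat)"

text \<open>
  \<open>(e, a, b)\<close> stands for a partition with Durfee rectangle of \<open>e\<close> rows and \<open>e + L\<close> columns: row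
  \<open>i < e\<close> sticks out of the rectangle by \<open>b i\<close> cells, column \<open>j < e + L\<close> by \<open>a j\<close> cells.  Unlike in
  \<open>part\<close>, indices start at 0.
\<close>

definition dissections :: "nat \<Rightarrow> dissection set" where
  "dissections L = {(e, a, b). a \<in> seqs (e + L) \<and> b \<in> seqs e}"

definition dsize :: "nat \<Rightarrow> dissection \<Rightarrow> nat" where
  "dsize L = (\<lambda>(e, a, b). e * (e + L) + (\<Sum>i<e+L. a i) + (\<Sum>i<e. b i))"

definition nested :: "nat \<Rightarrow> dissection set" where
  "nested L = {(e, a, b) \<in> dissections L. \<forall>j. a (j + L) \<le> b j}"

text \<open>For \<open>L = 0\<close>, a nonempty row \<open>j\<close> of the skew diagram
  \<open>b/a\<close> that shares no column with row \<open>j - 1\<close>. The case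
  \<open>j + L = 0\<close> is separate because \<open>a (j + L - 1)\<close> would then be read as
  \<open>a 0\<close>.\<close>

definition heads :: "nat \<Rightarrow> (nat \<Rightarrow> nat) \<Rightarrow> (nat \<Rightarrow> nat) \<Rightarrow> nat set" where
  "heads L a b = {j. a (j + L) < b j \<and> (j + L = 0 \<or> b j \<le> a (j + L - 1))}"

definition marked :: "nat \<Rightarrow> nat \<Rightarrow> (dissection \<times> nat set) set" where
  "marked L m = {((e, a, b), C). (e, a, b) \<in> nested L \<and> C \<subseteq> heads L a b \<and> card C = m}"

text \<open>
  A marked head \<open>j\<close> satisfies \<open>b j \<le> a (j + L - 1)\<close>, so \<open>b j - 1\<close> fits into \<open>a\<close> right after the
  decremented entries.  No head is left before position \<open>j\<close>, which makes \<open>j\<close> recoverable: it is the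
  \<open>pivot\<close> of the result.
\<close>

definition move :: "nat \<Rightarrow> dissection \<times> nat set \<Rightarrow> dissection \<times> nat set" where
  "move L = (\<lambda>((e, a, b), C). let j = Min C in
     ((e - 1,
       \<lambda>i. if i < j + L then a i - 1 else if i = j + L then b j - 1 else a (i - 1),
       \<lambda>i. if i < j then Suc (b i) else b (Suc i)),
      {u. Suc u \<in> C - {j}}))"

text \<open>Both \<open>move\<close> and \<open>swap\<close> raise \<open>b\<close> and lower
  \<open>a\<close> before their position \<open>j\<close>, which turns
  \<open>a (i + L) <= b i\<close> into a gap of at least 2; at \<open>j\<close> the gap is at most
  1. So one formula recovers \<open>j\<close> for both.\<close>

definition pivot :: "nat \<Rightarrow> (nat \<Rightarrow> nat) \<Rightarrow> (nat \<Rightarrow> nat) \<Rightarrow> nat" where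
  "pivot L a b = (LEAST j. b j \<le> Suc (a (j + L)))"

definition unmove :: "nat \<Rightarrow> dissection \<times> nat set \<Rightarrow> dissection \<times> nat set" where
  "unmove L = (\<lambda>((e, a, b), C). let j = pivot L a b in
     ((Suc e,
       \<lambda>i. if i < j + L then Suc (a i) else a (Suc i),
       \<lambda>i. if i < j then b i - 1 else if i = j then Suc (a (j + L)) else b (i - 1)),
      insert j (Suc ` C)))"

text \<open>At the first violation \<open>j\<close> of nestedness the tails of \<open>b\<close> from
  \<open>j\<close> and of \<open>a\<close> from \<open>j + L + 1\<close> change places. On
  non-nested pairs the decrement does not truncate, as \<open>a i >= a (j + L) > b j\<close>
  there.\<close>

definition swap :: "nat \<Rightarrow> dissection \<Rightarrow> dissection" where
  "swap L = (\<lambda>(e, a, b). let j = (LEAST j. b j < a (j + L)) in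
     (e - 1,
      \<lambda>i. if i \<le> j + L then a i - 1 else b (i - Suc L),
      \<lambda>i. if i < j then Suc (b i) else a (Suc (i + L))))"

definition unswap :: "nat \<Rightarrow> dissection \<Rightarrow> dissection" where
  "unswap L = (\<lambda>(e, a, b). let j = pivot L a b in
     (Suc e,
      \<lambda>i. if i \<le> j + L then Suc (a i) else b (i - Suc L),
      \<lambda>i. if i < j then b i - 1 else a (Suc (i + L))))"

section \<open>Elementary facts on sequences, pivots and heads\<close>

lemma seqs_antimono: "a \<in> seqs n \<Longrightarrow> i \<le> j \<Longrightarrow> a j \<le> a i"
  by (auto simp: seqs_def antimono_def)

lemma seqs_zero: "a \<in> seqs n \<Longrightarrow> n \<le> i \<Longrightarrow> a i = 0"
  by (auto simp: seqs_def)

lemma seqsI: "(\<And>i. a (Suc i) \<le> a i) \<Longrightarrow> (\<And>i. n \<le> i \<Longrightarrow> a i = 0) \<Longrightarrow> a \<in> seqs n"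
  by (auto simp: seqs_def antimono_iff_le_Suc)

lemma pivot_eqI:
  assumes "\<And>i. i < j \<Longrightarrow> Suc (Suc (a (i + L))) \<le> b i" "b j \<le> Suc (a (j + L))"
  shows "pivot L a b = j"
  unfolding pivot_def
proof (rule Least_equality)
  fix y assume "b y \<le> Suc (a (y + L))"
  then show "j \<le> y" using assms(1)[of y] by (meson not_less not_less_eq_eq order_trans)
qed (fact assms(2))

text \<open>The value \<open>b e = 0\<close> guarantees that a pivot exists and is at most
  \<open>e\<close>. The levels \<open>L\<close> and \<open>L'\<close> are kept apart because the
  pivot for \<open>L\<close> is taken in dissections for \<open>L + 2\<close>.\<close>

lemma pivot_props:
  assumes "(e, a, b) \<in> dissections L'"
  shows "pivot L a b \<le> e" "b (pivot L a b) \<le> Suc (a (pivot L a b + L))"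
    "i < pivot L a b \<Longrightarrow> Suc (Suc (a (i + L))) \<le> b i"
proof -
  have z: "b e \<le> Suc (a (e + L))"
    using assms by (auto simp: dissections_def seqs_def)
  show "pivot L a b \<le> e" unfolding pivot_def by (rule Least_le) (rule z)
  show "b (pivot L a b) \<le> Suc (a (pivot L a b + L))" unfolding pivot_def by (rule LeastI) (rule z)
  show "Suc (Suc (a (i + L))) \<le> b i" if "i < pivot L a b"
    using not_less_Least[OF that[unfolded pivot_def]] by simp
qed

lemma sum_lessThan_split_at:
  fixes f :: "nat \<Rightarrow> nat"
  assumes "p \<le> n"
  shows "(\<Sum>i<n. f i) = (\<Sum>i<p. f i) + (\<Sum>i<n-p. f (p + i))"
proof -
  have "{..<n} = {..<p} \<union> {p..<n}" using assms by auto
  then have "sum f {..<n} = sum f {..<p} + sum f {p..<n}"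
    by (simp add: sum.union_disjoint ivl_disj_int)
  also have "sum f {p..<n} = (\<Sum>i<n-p. f (p + i))"
    by (rule sum.reindex_bij_witness[of _ "\<lambda>i. p + i" "\<lambda>i. i - p"]) auto
  finally show ?thesis .
qed

lemma heads_finite:
  assumes "b \<in> seqs e"
  shows "heads L a b \<subseteq> {..<e}" "finite (heads L a b)"
proof -
  show "heads L a b \<subseteq> {..<e}"
  proof
    fix x assume "x \<in> heads L a b"
    then have "b x \<noteq> 0" by (auto simp: heads_def)
    then show "x \<in> {..<e}" using seqs_zero[OF assms, of x] by (cases "x < e") auto
  qed
  then show "finite (heads L a b)" by (rule finite_subset) simp
qed

lemma headsD:
  assumes "a \<in> seqs n" "j \<in> heads L a b"
  shows "a (j + L) < b j" "i < j + L \<Longrightarrow> b j \<le> a i"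
proof -
  show "a (j + L) < b j" using assms by (simp add: heads_def)
  assume "i < j + L"
  then have "i \<le> j + L - 1" "j + L \<noteq> 0" by linarith+
  moreover from this have "b j \<le> a (j + L - 1)" using assms(2) by (auto simp: heads_def)
  ultimately show "b j \<le> a i" using seqs_antimono[OF assms(1), of i "j + L - 1"] by linarith
qed

section \<open>Removing one marked part\<close>

text \<open>By \<open>(e + 1) * (e + 1 + L) = e * (e + L + 2) + L + 1\<close> the rectangle loses
  \<open>L + 1\<close> cells. Outside it \<open>a\<close> loses \<open>j + L\<close>, the moved part
  loses 1 and \<open>b\<close> gains \<open>j\<close>, again a net loss of
  \<open>L + 1\<close>.\<close>

lemma dsize_move:
  assumes "j \<le> e"
    and "\<And>i. i < j + L \<Longrightarrow> a i = Suc (a' i)" "b j = Suc (a' (j + L))" "\<And>i. j + L \<le> i \<Longrightarrow> a' (Suc i) = a i"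
    and "\<And>i. i < j \<Longrightarrow> b' i = Suc (b i)" "\<And>i. j \<le> i \<Longrightarrow> b' i = b (Suc i)"
  shows "dsize L (Suc e, a, b) = dsize (L + 2) (e, a', b') + 2 * L + 2"
proof -
  have "(\<Sum>i<Suc e + L. a i) = (\<Sum>i<j+L. a i) + (\<Sum>i<Suc e - j. a (j + L + i))"
    using assms(1) by (subst sum_lessThan_split_at[of "j + L"]) auto
  also have "(\<Sum>i<j+L. a i) = (\<Sum>i<j+L. a' i) + (j + L)"
    using assms(2) by (simp add: sum_Suc)
  finally have 1: "(\<Sum>i<Suc e + L. a i) = (\<Sum>i<j+L. a' i) + (j + L) + (\<Sum>i<Suc e - j. a (j + L + i))" .
  have "(\<Sum>i<e + (L + 2). a' i) = (\<Sum>i<j+L. a' i) + (\<Sum>i<Suc (Suc e - j). a' (j + L + i))"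
    using assms(1) by (subst sum_lessThan_split_at[of "j + L"]) (auto simp: Suc_diff_le)
  also have "(\<Sum>i<Suc (Suc e - j). a' (j + L + i)) = a' (j + L) + (\<Sum>i<Suc e - j. a (j + L + i))"
    using assms(4) by (subst sum.lessThan_Suc_shift) simp
  finally have 2: "(\<Sum>i<e + (L + 2). a' i) = (\<Sum>i<j+L. a' i) + a' (j + L) + (\<Sum>i<Suc e - j. a (j + L + i))"
    by simp
  have "(\<Sum>i<Suc e. b i) = (\<Sum>i<j. b i) + (\<Sum>i<Suc (e - j). b (j + i))"
    using assms(1) by (subst sum_lessThan_split_at[of j]) (auto simp: Suc_diff_le)
  also have "(\<Sum>i<Suc (e - j). b (j + i)) = b j + (\<Sum>i<e - j. b' (j + i))"
    using assms(6) by (subst sum.lessThan_Suc_shift) simp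
  finally have 3: "(\<Sum>i<Suc e. b i) = (\<Sum>i<j. b i) + b j + (\<Sum>i<e - j. b' (j + i))"
    by simp
  have "(\<Sum>i<e. b' i) = (\<Sum>i<j. b' i) + (\<Sum>i<e - j. b' (j + i))"
    using assms(1) by (rule sum_lessThan_split_at)
  also have "(\<Sum>i<j. b' i) = (\<Sum>i<j. b i) + j"
    using assms(5) by (simp add: sum_Suc)
  finally have 4: "(\<Sum>i<e. b' i) = (\<Sum>i<j. b i) + j + (\<Sum>i<e - j. b' (j + i))" .
  show ?thesis
    unfolding dsize_def prod.case 1 2 3 4 assms(3) by (simp add: algebra_simps)
qed

lemma move_marked:
  assumes "((e, a, b), C) \<in> marked L (Suc m)"
  shows "move L ((e, a, b), C) \<in> marked (L + 2) m"
    and "unmove L (move L ((e, a, b), C)) = ((e, a, b), C)"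
    and "dsize L (e, a, b) = dsize (L + 2) (fst (move L ((e, a, b), C))) + 2 * L + 2"
proof -
  define j where "j = Min C"
  have a: "a \<in> seqs (e + L)" and b: "b \<in> seqs e" and nst: "\<And>i. a (i + L) \<le> b i"
    and C: "C \<subseteq> heads L a b" "card C = Suc m"
    using assms by (auto simp: marked_def nested_def dissections_def)
  have fin: "finite C" and ne: "C \<noteq> {}" using C(2) by (auto intro: card_ge_0_finite)
  have jC: "j \<in> C" unfolding j_def using fin ne by simp
  have jmin: "j \<le> u" if "u \<in> C" for u unfolding j_def using fin that by simp
  have jh: "j \<in> heads L a b" using jC C by auto
  note h1 = headsD(1)[OF a jh] and h2 = headsD(2)[OF a jh]
  have je: "j < e" using heads_finite(1)[OF b] jh by blast
  define a' where "a' = (\<lambda>i. if i < j + L then a i - 1 else if i = j + L then b j - 1 else a (i - 1))"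
  define b' where "b' = (\<lambda>i. if i < j then Suc (b i) else b (Suc i))"
  define C' where "C' = {u. Suc u \<in> C - {j}}"
  have mv: "move L ((e, a, b), C) = ((e - 1, a', b'), C')"
    unfolding move_def prod.case Let_def j_def[symmetric] a'_def b'_def C'_def ..
  have A1: "a i = Suc (a' i)" if "i < j + L" for i
    using h1 h2[OF that] that by (simp add: a'_def)
  have A2: "b j = Suc (a' (j + L))" using h1 by (simp add: a'_def)
  have A3: "a' (Suc i) = a i" if "j + L \<le> i" for i using that by (simp add: a'_def)
  have B1: "b' i = Suc (b i)" if "i < j" for i using that by (simp add: b'_def)
  have B2: "b' i = b (Suc i)" if "j \<le> i" for i using that by (simp add: b'_def)
  \<comment> \<open>At the seams, \<open>a i >= b j\<close> for \<open>i < j + L\<close> and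
    \<open>a (j + L) <= b j - 1\<close>: exactly the conditions for \<open>j\<close> to be a
    head.\<close>
  have a': "a' \<in> seqs (e - 1 + (L + 2))"
  proof (rule seqsI)
    fix i
    consider "Suc i < j + L" | "Suc i = j + L" | "i = j + L" | "j + L < i" by linarith
    then show "a' (Suc i) \<le> a' i"
    proof cases
      case 1 then show ?thesis using A1[of i] A1[of "Suc i"] seqs_antimono[OF a, of i "Suc i"] by simp
    next
      case 2 then show ?thesis using A1[of i] A2 h2[of i] by simp
    next
      case 3 then show ?thesis using A3[of i] A2 h1 by simp
    next
      case 4
      then have "a' i = a (i - 1)" using A3[of "i - 1"] by simp
      then show ?thesis using 4 A3[of i] seqs_antimono[OF a, of "i - 1" i] by simp
    qed
    assume "e - 1 + (L + 2) \<le> i"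
    then show "a' i = 0" using je seqs_zero[OF a, of "i - 1"] by (simp add: a'_def)
  qed
  have b': "b' \<in> seqs (e - 1)"
  proof (rule seqsI)
    fix i
    show "b' (Suc i) \<le> b' i"
      using seqs_antimono[OF b, of i "Suc i"] seqs_antimono[OF b, of "Suc i" "Suc (Suc i)"] by (simp add: b'_def)
    assume "e - 1 \<le> i" then show "b' i = 0" using je seqs_zero[OF b, of "Suc i"] by (simp add: b'_def)
  qed
  have nst': "a' (i + (L + 2)) \<le> b' i" for i
  proof (cases "i < j")
    case True
    have "a' (i + (L + 2)) \<le> a' (i + L)" using seqs_antimono[OF a'] by simp
    also have "\<dots> \<le> b i" using A1[of "i + L"] nst[of i] True by simp
    finally show ?thesis using B1 True by simp
  next
    case False then show ?thesis using A3[of "i + L + 1"] B2[of i] nst[of "Suc i"] by simp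
  qed
  \<comment> \<open>As \<open>j\<close> is minimal in \<open>C\<close>, no other mark is 0, so
    lowering the remaining marks by 1 loses none.\<close>
  have SC: "Suc ` C' = C - {j}"
  proof -
    have "u \<in> Suc ` C'" if "u \<in> C - {j}" for u
      using that jmin[of u] by (cases u) (auto simp: C'_def)
    then show ?thesis by (auto simp: C'_def)
  qed
  \<comment> \<open>The remaining marks lie beyond \<open>j\<close>, where the head condition for
    \<open>u\<close> at level \<open>L + 2\<close> involves the same entries as that for
    \<open>Suc u\<close> at level \<open>L\<close>.\<close>
  have C'h: "C' \<subseteq> heads (L + 2) a' b'"
  proof
    fix u assume "u \<in> C'"
    then have u: "Suc u \<in> C" "Suc u \<noteq> j" by (auto simp: C'_def)
    then have ju: "j \<le> u" using jmin[of "Suc u"] by simp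
    have "Suc u \<in> heads L a b" using u C by auto
    then have "a (Suc u + L) < b (Suc u)" "b (Suc u) \<le> a (u + L)" by (auto simp: heads_def)
    then show "u \<in> heads (L + 2) a' b'"
      using A3[of "Suc u + L"] A3[of "u + L"] B2[OF ju] ju by (simp add: heads_def)
  qed
  have "card C' = card (C - {j})" unfolding SC[symmetric] by (simp add: card_image)
  then have "card C' = m" using jC C(2) fin by simp
  with a' b' nst' C'h show "move L ((e, a, b), C) \<in> marked (L + 2) m"
    unfolding mv by (simp add: marked_def nested_def dissections_def)
  have pv: "pivot L a' b' = j"
  proof (rule pivot_eqI)
    show "Suc (Suc (a' (i + L))) \<le> b' i" if "i < j" for i
      using that A1[of "i + L"] B1[of i] nst[of i] by simp
    show "b' j \<le> Suc (a' (j + L))" using B2[of j] A2 seqs_antimono[OF b, of j "Suc j"] by simp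
  qed
  have ra: "(\<lambda>i. if i < j + L then Suc (a' i) else a' (Suc i)) = a"
    using A1 A3 by (auto simp: fun_eq_iff)
  have rb: "(\<lambda>i. if i < j then b' i - 1 else if i = j then Suc (a' (j + L)) else b' (i - 1)) = b"
    using B1 B2 A2 by (auto simp: fun_eq_iff)
  have rC: "insert j (Suc ` C') = C" using SC jC by auto
  show "unmove L (move L ((e, a, b), C)) = ((e, a, b), C)"
    unfolding mv unmove_def prod.case Let_def pv ra rb rC using je by simp
  have e: "Suc (e - 1) = e" using je by simp
  have "dsize L (Suc (e - 1), a, b) = dsize (L + 2) (e - 1, a', b') + 2 * L + 2"
  proof (rule dsize_move[where j = j])
    show "j \<le> e - 1" using je by simp
  qed (fact A1 A2 A3 B1 B2)+
  then show "dsize L (e, a, b) = dsize (L + 2) (fst (move L ((e, a, b), C))) + 2 * L + 2"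
    unfolding mv e fst_conv .
qed

lemma unmove_marked:
  assumes "((e, a', b'), C') \<in> marked (L + 2) m"
  shows "unmove L ((e, a', b'), C') \<in> marked L (Suc m)"
    and "move L (unmove L ((e, a', b'), C')) = ((e, a', b'), C')"
proof -
  define j where "j = pivot L a' b'"
  have a': "a' \<in> seqs (e + (L + 2))" and b': "b' \<in> seqs e" and nst': "\<And>i. a' (i + (L + 2)) \<le> b' i"
    and C': "C' \<subseteq> heads (L + 2) a' b'" "card C' = m"
    and D: "(e, a', b') \<in> dissections (L + 2)"
    using assms by (auto simp: marked_def nested_def dissections_def)
  note pv = pivot_props[OF D, where L = L, folded j_def]
  define a where "a = (\<lambda>i. if i < j + L then Suc (a' i) else a' (Suc i))"
  define b where "b = (\<lambda>i. if i < j then b' i - 1 else if i = j then Suc (a' (j + L)) else b' (i - 1))"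
  have um: "unmove L ((e, a', b'), C') = ((Suc e, a, b), insert j (Suc ` C'))"
    unfolding unmove_def prod.case Let_def j_def[symmetric] a_def b_def ..
  have A1: "a i = Suc (a' i)" if "i < j + L" for i using that by (simp add: a_def)
  have A2: "b j = Suc (a' (j + L))" by (simp add: b_def)
  have A3: "a' (Suc i) = a i" if "j + L \<le> i" for i using that by (simp add: a_def)
  have B1: "b' i = Suc (b i)" if "i < j" for i using that pv(3)[of i] by (simp add: b_def)
  have B2: "b' i = b (Suc i)" if "j \<le> i" for i using that by (simp add: b_def)
  have a: "a \<in> seqs (Suc e + L)"
  proof (rule seqsI)
    fix i
    show "a (Suc i) \<le> a i"
      using seqs_antimono[OF a', of i "Suc i"] seqs_antimono[OF a', of "Suc i" "Suc (Suc i)"]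
      by (simp add: a_def)
    assume "Suc e + L \<le> i"
    then show "a i = 0" using pv(1) seqs_zero[OF a', of "Suc i"] by (simp add: a_def)
  qed
  \<comment> \<open>The seams around the inserted part are the two halves of the pivot property:
    \<open>b' (j - 1) >= a' (j - 1 + L) + 2\<close> and
    \<open>b' j <= a' (j + L) + 1\<close>.\<close>
  have b: "b \<in> seqs (Suc e)"
  proof (rule seqsI)
    fix i
    consider "Suc i < j" | "Suc i = j" | "i = j" | "j < i" by linarith
    then show "b (Suc i) \<le> b i"
    proof cases
      case 1 then show ?thesis using B1[of i] B1[of "Suc i"] seqs_antimono[OF b', of i "Suc i"] by simp
    next
      case 2 then show ?thesis
        using B1[of i] A2 pv(3)[of i] seqs_antimono[OF a', of "i + L" "j + L"] by simp
    next
      case 3 then show ?thesis using B2[of i] A2 pv(2) by simp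
    next
      case 4
      then have "b i = b' (i - 1)" using B2[of "i - 1"] by simp
      then show ?thesis using 4 B2[of i] seqs_antimono[OF b', of "i - 1" i] by simp
    qed
    assume "Suc e \<le> i"
    then show "b i = 0" using pv(1) seqs_zero[OF b', of "i - 1"] by (simp add: b_def)
  qed
  have nst: "a (i + L) \<le> b i" for i
  proof -
    consider "i < j" | "i = j" | "j < i" by linarith
    then show ?thesis
    proof cases
      case 1 then show ?thesis using A1[of "i + L"] B1[of i] pv(3)[of i] by simp
    next
      case 2 then show ?thesis using A3[of "i + L"] A2 seqs_antimono[OF a', of "j + L" "Suc (j + L)"] by simp
    next
      case 3
      then show ?thesis using A3[of "i + L"] B2[of "i - 1"] nst'[of "i - 1"] by (cases i) auto
    qed
  qed
  \<comment> \<open>The inserted part \<open>a' (j + L) + 1\<close> lies above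
    \<open>a' (j + L + 1)\<close> and is at most \<open>a' (j + L - 1) + 1\<close>; these are the
    new \<open>a (j + L)\<close> and \<open>a (j + L - 1)\<close>.\<close>
  have jh: "j \<in> heads L a b"
  proof -
    have "a (j + L) < b j" using A3[of "j + L"] A2 seqs_antimono[OF a', of "j + L" "Suc (j + L)"] by simp
    moreover have "b j \<le> a (j + L - 1)" if "j + L \<noteq> 0"
      using that A1[of "j + L - 1"] A2 seqs_antimono[OF a', of "j + L - 1" "j + L"] by simp
    ultimately show ?thesis by (cases "j + L = 0") (auto simp: heads_def)
  qed
  \<comment> \<open>A head \<open>u\<close> at level \<open>L + 2\<close> has
    \<open>b' u <= a' (u + L + 1)\<close>, against the gap of 2 before the pivot. So the shifted old
    marks all come after \<open>j\<close>, which is the new minimum.\<close>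
  have uj: "j \<le> u" if "u \<in> C'" for u
  proof (rule ccontr)
    assume "\<not> j \<le> u"
    then have "Suc (Suc (a' (u + L))) \<le> b' u" using pv(3)[of u] by simp
    moreover have "b' u \<le> a' (u + L + 1)" using that C'(1) by (auto simp: heads_def)
    moreover have "a' (u + L + 1) \<le> a' (u + L)" by (rule seqs_antimono[OF a']) simp
    ultimately show False by linarith
  qed
  have Sh: "Suc u \<in> heads L a b" if "u \<in> C'" for u
  proof -
    have "a' (u + L + 2) < b' u" "b' u \<le> a' (u + L + 1)" using that C'(1) by (auto simp: heads_def)
    then show ?thesis using uj[OF that] A3[of "u + L"] A3[of "Suc u + L"] B2[of u] by (simp add: heads_def)
  qed
  have "finite C'" using C'(1) heads_finite(2)[OF b'] finite_subset by blast
  moreover have jn: "j \<notin> Suc ` C'" using uj by fastforce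
  ultimately have "card (insert j (Suc ` C')) = Suc m" using C'(2) by (simp add: card_image)
  with a b nst jh Sh show "unmove L ((e, a', b'), C') \<in> marked L (Suc m)"
    unfolding um by (auto simp: marked_def nested_def dissections_def)
  have mn: "Min (insert j (Suc ` C')) = j"
    by (rule Min_eqI) (use \<open>finite C'\<close> uj in \<open>auto simp: le_SucI\<close>)
  have ra: "(\<lambda>i. if i < j + L then a i - 1 else if i = j + L then b j - 1 else a (i - 1)) = a'"
  proof
    fix i show "(if i < j + L then a i - 1 else if i = j + L then b j - 1 else a (i - 1)) = a' i"
      using A1[of i] A2 A3[of "i - 1"] by (cases i) auto
  qed
  have rb: "(\<lambda>i. if i < j then Suc (b i) else b (Suc i)) = b'"
    using B1 B2 by (auto simp: fun_eq_iff)
  have rC: "{u. Suc u \<in> insert j (Suc ` C') - {j}} = C'" using jn by auto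
  show "move L (unmove L ((e, a', b'), C')) = ((e, a', b'), C')"
    unfolding um move_def prod.case Let_def mn ra rb rC by simp
qed

lemma bij_move: "bij_betw (move L) (marked L (Suc m)) (marked (L + 2) m)"
proof (rule bij_betw_byWitness[where f' = "unmove L"])
  show "\<forall>x\<in>marked L (Suc m). unmove L (move L x) = x" using move_marked(2) by fast
  show "\<forall>x\<in>marked (L + 2) m. move L (unmove L x) = x" using unmove_marked(2) by fast
  show "move L ` marked L (Suc m) \<subseteq> marked (L + 2) m"
    by (intro image_subsetI, simp only: split_paired_all, rule move_marked(1))
  show "unmove L ` marked (L + 2) m \<subseteq> marked L (Suc m)"
    by (intro image_subsetI, simp only: split_paired_all, rule unmove_marked(1))
qed

section \<open>Reflection of the non-nested pairs\<close>

lemma swap_not_nested: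
  assumes "(e, a, b) \<in> dissections L - nested L"
  shows "swap L (e, a, b) \<in> dissections (L + 2)"
    and "unswap L (swap L (e, a, b)) = (e, a, b)"
    and "dsize L (e, a, b) = dsize (L + 2) (swap L (e, a, b)) + 2 * L + 2"
proof -
  define j where "j = (LEAST j. b j < a (j + L))"
  have a: "a \<in> seqs (e + L)" and b: "b \<in> seqs e" and ex: "\<exists>i. b i < a (i + L)"
    using assms by (auto simp: nested_def dissections_def not_le)
  have h1: "b j < a (j + L)" unfolding j_def by (rule LeastI_ex) (rule ex)
  have h2: "a (i + L) \<le> b i" if "i < j" for i
    using not_less_Least[OF that[unfolded j_def]] by simp
  have je: "j < e" using seqs_zero[OF a, of "j + L"] h1 by (cases "j < e") auto
  define a' where "a' = (\<lambda>i. if i \<le> j + L then a i - 1 else b (i - Suc L))"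
  define b' where "b' = (\<lambda>i. if i < j then Suc (b i) else a (Suc (i + L)))"
  have sw: "swap L (e, a, b) = (e - 1, a', b')"
    by (simp add: swap_def Let_def j_def[symmetric] a'_def b'_def)
  have A1: "a i = Suc (a' i)" if "i \<le> j + L" for i
    using h1 that seqs_antimono[OF a that] by (simp add: a'_def)
  have A2: "a' (Suc (i + L)) = b i" if "j \<le> i" for i using that by (simp add: a'_def)
  have B1: "b' i = Suc (b i)" if "i < j" for i using that by (simp add: b'_def)
  have B2: "b' i = a (Suc (i + L))" if "j \<le> i" for i using that by (simp add: b'_def)
  \<comment> \<open>The seam at \<open>j + L\<close> holds because \<open>j\<close> is a violation:
    \<open>b j <= a (j + L) - 1\<close>.\<close>
  have a': "a' \<in> seqs (e - 1 + (L + 2))"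
  proof (rule seqsI)
    fix i
    consider "i < j + L" | "i = j + L" | "j + L < i" by linarith
    then show "a' (Suc i) \<le> a' i"
    proof cases
      case 1 then show ?thesis using A1[of i] A1[of "Suc i"] seqs_antimono[OF a, of i "Suc i"] by simp
    next
      case 2 then show ?thesis using A1[of i] A2[of j] h1 by simp
    next
      case 3
      define k where "k = i - Suc L"
      have k: "i = Suc (k + L)" "j \<le> k" using 3 by (auto simp: k_def)
      show ?thesis using k A2[of k] A2[of "Suc k"] seqs_antimono[OF b, of k "Suc k"] by simp
    qed
    assume "e - 1 + (L + 2) \<le> i"
    then show "a' i = 0" using je seqs_zero[OF b, of "i - Suc L"] by (simp add: a'_def)
  qed
  \<comment> \<open>The seam before \<open>j\<close> holds because \<open>j\<close> is the first
    violation: \<open>b (j - 1) + 1 > a (j - 1 + L) >= a (j + L + 1)\<close>.\<close>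
  have b': "b' \<in> seqs (e - 1)"
  proof (rule seqsI)
    fix i
    consider "Suc i < j" | "Suc i = j" | "j \<le> i" by linarith
    then show "b' (Suc i) \<le> b' i"
    proof cases
      case 1 then show ?thesis using B1[of i] B1[of "Suc i"] seqs_antimono[OF b, of i "Suc i"] by simp
    next
      case 2 then show ?thesis
        using B1[of i] B2[of j] h2[of i] seqs_antimono[OF a, of "i + L" "Suc (j + L)"] by simp
    next
      case 3 then show ?thesis using B2[of i] B2[of "Suc i"] seqs_antimono[OF a, of "Suc (i + L)" "Suc (Suc (i + L))"] by simp
    qed
    assume "e - 1 \<le> i" then show "b' i = 0" using je seqs_zero[OF a, of "Suc (i + L)"] by (simp add: b'_def)
  qed
  show "swap L (e, a, b) \<in> dissections (L + 2)"
    unfolding sw using a' b' by (simp add: dissections_def)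
  have pv: "pivot L a' b' = j"
  proof (rule pivot_eqI)
    show "Suc (Suc (a' (i + L))) \<le> b' i" if "i < j" for i
      using that A1[of "i + L"] B1[of i] h2[of i] by simp
    show "b' j \<le> Suc (a' (j + L))"
      using B2[of j] A1[of "j + L"] seqs_antimono[OF a, of "j + L" "Suc (j + L)"] by simp
  qed
  have ra: "(\<lambda>i. if i \<le> j + L then Suc (a' i) else b' (i - Suc L)) = a"
  proof
    fix i show "(if i \<le> j + L then Suc (a' i) else b' (i - Suc L)) = a i"
      using A1[of i] B2[of "i - Suc L"] by simp
  qed
  have rb: "(\<lambda>i. if i < j then b' i - 1 else a' (Suc (i + L))) = b"
    using B1 A2 by (auto simp: fun_eq_iff)
  show "unswap L (swap L (e, a, b)) = (e, a, b)"
    unfolding sw unswap_def prod.case Let_def pv ra rb using je by simp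
  \<comment> \<open>The rectangle loses \<open>L + 1\<close> cells, \<open>j + L + 1\<close> entries
    of \<open>a\<close> drop by 1, \<open>j\<close> entries of \<open>b\<close> grow by 1, and the
    tails only change places: a loss of \<open>2 * L + 2\<close> in all.\<close>
  have "(\<Sum>i<e + L. a i) = (\<Sum>i<Suc (j+L). a i) + (\<Sum>i<e - Suc j. a (Suc (j + L) + i))"
    using je by (subst sum_lessThan_split_at[of "Suc (j + L)"]) (auto simp del: sum.lessThan_Suc)
  also have "(\<Sum>i<Suc (j+L). a i) = (\<Sum>i<Suc (j+L). a' i) + Suc (j + L)"
  proof -
    have "(\<Sum>i<Suc (j+L). a i) = (\<Sum>i<Suc (j+L). Suc (a' i))"
      by (rule sum.cong) (use A1 in auto)
    then show ?thesis by (simp only: sum_Suc card_lessThan)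
  qed
  also have "(\<Sum>i<e - Suc j. a (Suc (j + L) + i)) = (\<Sum>i<e - 1 - j. b' (j + i))"
    by (rule sum.cong) (use B2[of "j + i" for i] in \<open>auto simp: add_ac\<close>)
  finally have 1: "(\<Sum>i<e + L. a i) = (\<Sum>i<Suc (j+L). a' i) + Suc (j + L) + (\<Sum>i<e - 1 - j. b' (j + i))" .
  have "(\<Sum>i<e - 1 + (L + 2). a' i) = (\<Sum>i<Suc (j+L). a' i) + (\<Sum>i<e - j. a' (Suc (j + L) + i))"
    using je by (subst sum_lessThan_split_at[of "Suc (j + L)"]) (auto simp del: sum.lessThan_Suc)
  also have "(\<Sum>i<e - j. a' (Suc (j + L) + i)) = (\<Sum>i<e - j. b (j + i))"
    by (rule sum.cong) (use A2[of "j + i" for i] in \<open>auto simp: add_ac\<close>)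
  finally have 2: "(\<Sum>i<e - 1 + (L + 2). a' i) = (\<Sum>i<Suc (j+L). a' i) + (\<Sum>i<e - j. b (j + i))" .
  have 3: "(\<Sum>i<e. b i) = (\<Sum>i<j. b i) + (\<Sum>i<e - j. b (j + i))"
    using je by (intro sum_lessThan_split_at) simp
  have "(\<Sum>i<e - 1. b' i) = (\<Sum>i<j. b' i) + (\<Sum>i<e - 1 - j. b' (j + i))"
    using je by (intro sum_lessThan_split_at) simp
  also have "(\<Sum>i<j. b' i) = (\<Sum>i<j. b i) + j"
    using B1 by (simp add: sum_Suc)
  finally have 4: "(\<Sum>i<e - 1. b' i) = (\<Sum>i<j. b i) + j + (\<Sum>i<e - 1 - j. b' (j + i))" .
  obtain k where e: "e = Suc k" using je by (cases e) auto
  show "dsize L (e, a, b) = dsize (L + 2) (swap L (e, a, b)) + 2 * L + 2"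
    unfolding sw dsize_def prod.case 1 2 3 4 by (simp add: e algebra_simps)
qed

text \<open>Every dissection for \<open>L + 2\<close> has a pivot, so the tails can always be
  exchanged back. The pivot becomes the first violation: monotonicity of \<open>a'\<close> gives
  \<open>b j < a (j + L)\<close>, and the gap before \<open>j\<close> excludes earlier ones.\<close>

lemma unswap_dissections:
  assumes D: "(e, a', b') \<in> dissections (L + 2)"
  shows "unswap L (e, a', b') \<in> dissections L - nested L"
    and "swap L (unswap L (e, a', b')) = (e, a', b')"
proof -
  define j where "j = pivot L a' b'"
  have a': "a' \<in> seqs (e + (L + 2))" and b': "b' \<in> seqs e"
    using assms by (auto simp: dissections_def)
  note pv = pivot_props[OF D, where L = L, folded j_def]
  define a where "a = (\<lambda>i. if i \<le> j + L then Suc (a' i) else b' (i - Suc L))"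
  define b where "b = (\<lambda>i. if i < j then b' i - 1 else a' (Suc (i + L)))"
  have us: "unswap L (e, a', b') = (Suc e, a, b)"
    by (simp add: unswap_def Let_def j_def[symmetric] a_def b_def)
  have A1: "a i = Suc (a' i)" if "i \<le> j + L" for i using that by (simp add: a_def)
  have A2: "a' (Suc (i + L)) = b i" if "j \<le> i" for i using that by (simp add: b_def)
  have B1: "b' i = Suc (b i)" if "i < j" for i using that pv(3)[of i] by (simp add: b_def)
  have B2: "b' i = a (Suc (i + L))" if "j \<le> i" for i using that by (simp add: a_def)
  have a: "a \<in> seqs (Suc e + L)"
  proof (rule seqsI)
    fix i
    consider "i < j + L" | "i = j + L" | "j + L < i" by linarith
    then show "a (Suc i) \<le> a i"
    proof cases
      case 1 then show ?thesis using A1[of i] A1[of "Suc i"] seqs_antimono[OF a', of i "Suc i"] by simp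
    next
      case 2 then show ?thesis using A1[of i] B2[of j] pv(2) by simp
    next
      case 3
      define k where "k = i - Suc L"
      have k: "i = Suc (k + L)" "j \<le> k" using 3 by (auto simp: k_def)
      show ?thesis using k B2[of k] B2[of "Suc k"] seqs_antimono[OF b', of k "Suc k"] by simp
    qed
    assume "Suc e + L \<le> i"
    then show "a i = 0" using pv(1) seqs_zero[OF b', of "i - Suc L"] by (simp add: a_def)
  qed
  have b: "b \<in> seqs (Suc e)"
  proof (rule seqsI)
    fix i
    consider "Suc i < j" | "Suc i = j" | "j \<le> i" by linarith
    then show "b (Suc i) \<le> b i"
    proof cases
      case 1 then show ?thesis using B1[of i] B1[of "Suc i"] seqs_antimono[OF b', of i "Suc i"] by simp
    next
      case 2 then show ?thesis
        using B1[of i] A2[of j] pv(3)[of i] seqs_antimono[OF a', of "i + L" "Suc (j + L)"] by simp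
    next
      case 3 then show ?thesis using A2[of i] A2[of "Suc i"] seqs_antimono[OF a', of "Suc (i + L)" "Suc (Suc (i + L))"] by simp
    qed
    assume "Suc e \<le> i"
    then show "b i = 0" using pv(1) seqs_zero[OF a', of "Suc (i + L)"] by (simp add: b_def)
  qed
  have h1: "b j < a (j + L)"
    using A1[of "j + L"] A2[of j] seqs_antimono[OF a', of "j + L" "Suc (j + L)"] by simp
  have h2: "a (i + L) \<le> b i" if "i < j" for i
    using that A1[of "i + L"] B1[of i] pv(3)[of i] by simp
  show "unswap L (e, a', b') \<in> dissections L - nested L"
    unfolding us using a b h1 by (auto simp: dissections_def nested_def not_le)
  have lj: "(LEAST j. b j < a (j + L)) = j"
  proof (rule Least_equality)
    show "j \<le> y" if "b y < a (y + L)" for y using that h2[of y] by (cases "y < j") auto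
  qed (rule h1)
  have ra: "(\<lambda>i. if i \<le> j + L then a i - 1 else b (i - Suc L)) = a'"
  proof
    fix i show "(if i \<le> j + L then a i - 1 else b (i - Suc L)) = a' i"
      using A1[of i] A2[of "i - Suc L"] by (cases "i \<le> j + L") auto
  qed
  have rb: "(\<lambda>i. if i < j then Suc (b i) else a (Suc (i + L))) = b'"
    using B1 B2 by (auto simp: fun_eq_iff)
  show "swap L (unswap L (e, a', b')) = (e, a', b')"
    unfolding us swap_def prod.case Let_def lj ra rb by simp
qed

lemma bij_swap: "bij_betw (swap L) (dissections L - nested L) (dissections (L + 2))"
proof (rule bij_betw_byWitness[where f' = "unswap L"])
  show "\<forall>x\<in>dissections L - nested L. unswap L (swap L x) = x" using swap_not_nested(2) by fast
  show "\<forall>x\<in>dissections (L + 2). swap L (unswap L x) = x" using unswap_dissections(2) by fast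
  show "swap L ` (dissections L - nested L) \<subseteq> dissections (L + 2)"
    by (intro image_subsetI, simp only: split_paired_all, rule swap_not_nested(1))
  show "unswap L ` dissections (L + 2) \<subseteq> dissections L - nested L"
    by (intro image_subsetI, simp only: split_paired_all, rule unswap_dissections(1))
qed

section \<open>Durfee rectangles\<close>

definition col :: "(nat \<Rightarrow> nat) \<Rightarrow> nat \<Rightarrow> nat" where
  "col p j = card {i. j < p i}"

definition row_length :: "nat list \<Rightarrow> nat \<Rightarrow> nat" where
  "row_length l i = part l (Suc i)"

definition list_of :: "(nat \<Rightarrow> nat) \<Rightarrow> nat list" where
  "list_of p = map p [0..<col p 0]"

text \<open>Row \<open>e\<close> is the first with at most \<open>e + L\<close> cells, so the rows
  before it contain the Durfee rectangle; for \<open>e = 0\<close> that degenerates to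
  \<open>L\<close> columns of height 0. Entries outside its range are set to 0 to land in
  \<open>seqs\<close>.\<close>

definition dissect :: "nat \<Rightarrow> nat list \<Rightarrow> dissection" where
  "dissect L l = (let e = (LEAST e. row_length l e \<le> e + L) in
     (e, \<lambda>j. if j < e + L then col (row_length l) j - e else 0, \<lambda>i. if i < e then row_length l i - (e + L) else 0))"

definition glue :: "nat \<Rightarrow> dissection \<Rightarrow> nat \<Rightarrow> nat" where
  "glue L = (\<lambda>(e, a, b) i. if i < e then e + L + b i else col a (i - e))"

lemma less_iff_eqI: "(\<And>i. i < x \<longleftrightarrow> i < y) \<Longrightarrow> x = (y :: nat)"
  by (metis less_irrefl linorder_neqE_nat)

text \<open>By monotonicity the counted rows form an initial segment. This symmetric form of
  conjugation lets most later arguments avoid \<open>card\<close>.\<close>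

lemma less_col_iff:
  assumes "p \<in> seqs N"
  shows "i < col p j \<longleftrightarrow> j < p i"
proof -
  define k where "k = (LEAST k. p k \<le> j)"
  have "p N \<le> j" using seqs_zero[OF assms] by simp
  then have k: "p k \<le> j" unfolding k_def by (rule LeastI)
  have "{i. j < p i} = {..<k}"
  proof (intro set_eqI iffI)
    fix i assume "i \<in> {i. j < p i}"
    then show "i \<in> {..<k}" using k seqs_antimono[OF assms, of k i] by (cases "i < k") auto
  next
    fix i assume "i \<in> {..<k}"
    then show "i \<in> {i. j < p i}" using not_less_Least[of i "\<lambda>k. p k \<le> j"] by (simp add: k_def)
  qed
  then have "col p j = k" "j < p i \<longleftrightarrow> i < k" by (auto simp: col_def)
  then show ?thesis by simp
qed

lemma col_seqs:
  assumes "p \<in> seqs N"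
  shows "col p \<in> seqs (p 0)"
proof (rule seqsI)
  show "col p (Suc j) \<le> col p j" for j
  proof (rule ccontr)
    assume "\<not> ?thesis"
    then have "col p j < col p (Suc j)" by simp
    then show False using less_col_iff[OF assms] by (metis Suc_lessD less_irrefl)
  qed
  show "col p j = 0" if "p 0 \<le> j" for j
    using less_col_iff[OF assms, of 0 j] that by (cases "col p j = 0") auto
qed

lemma sum_col:
  assumes "a \<in> seqs M" "a 0 \<le> N"
  shows "(\<Sum>k<N. col a k) = (\<Sum>j<M. a j)"
proof -
  have *: "card {i \<in> {..<n}. i < c} = c" if "c \<le> n" for n c :: nat
  proof -
    have "{i \<in> {..<n}. i < c} = {..<c}" using that by auto
    then show ?thesis by simp
  qed
  have "col a k = (\<Sum>j<M. if k < a j then 1 else 0)" for k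
  proof -
    have "i < M" if "k < a i" for i using that seqs_zero[OF assms(1), of i] by (cases "i < M") auto
    then have "{i. k < a i} = {i \<in> {..<M}. k < a i}" by auto
    then have "col a k = card {i \<in> {..<M}. k < a i}" by (simp add: col_def)
    also have "\<dots> = (\<Sum>j<M. if k < a j then 1 else 0)"
      unfolding card_eq_sum by (rule sum.inter_filter) simp
    finally show ?thesis .
  qed
  then have "(\<Sum>k<N. col a k) = (\<Sum>k<N. \<Sum>j<M. if k < a j then 1 else 0)" by simp
  also have "\<dots> = (\<Sum>j<M. \<Sum>k<N. if k < a j then 1 else 0)" by (rule sum.swap)
  also have "\<dots> = (\<Sum>j<M. card {k \<in> {..<N}. k < a j})"
    by (simp only: card_eq_sum sum.inter_filter finite_lessThan)
  also have "\<dots> = (\<Sum>j<M. a j)"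
  proof (rule sum.cong[OF refl])
    fix j
    have "a j \<le> N" using seqs_antimono[OF assms(1), of 0 j] assms(2) by simp
    then show "card {k \<in> {..<N}. k < a j} = a j" by (rule *)
  qed
  finally show ?thesis .
qed

lemma row_length_eq: "row_length l i = (if i < length l then l ! i else 0)"
  by (auto simp: row_length_def part_def)

lemma row_length_seqs:
  assumes "is_partition l"
  shows "row_length l \<in> seqs (length l)"
  using assms by (intro seqsI) (auto simp: row_length_eq is_partition_def sorted_wrt_iff_nth_less)

lemma row_length_list_of:
  assumes "p \<in> seqs N"
  shows "row_length (list_of p) = p"
proof
  fix i show "row_length (list_of p) i = p i"
    using less_col_iff[OF assms, of i 0] by (auto simp: row_length_eq list_of_def)
qed

lemma is_partition_list_of:
  assumes "p \<in> seqs N"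
  shows "is_partition (list_of p)"
proof -
  have "sorted_wrt (\<lambda>i j. p j \<le> p i) [0..<col p 0]"
    using seqs_antimono[OF assms] by (simp add: sorted_wrt_iff_nth_less)
  then show ?thesis
    using less_col_iff[OF assms, of _ 0] by (auto simp: is_partition_def list_of_def sorted_wrt_map)
qed

lemma list_of_rows:
  assumes "is_partition l"
  shows "list_of (row_length l) = l"
proof -
  have "i < col (row_length l) 0 \<longleftrightarrow> i < length l" for i
    using less_col_iff[OF row_length_seqs[OF assms], of i 0] assms by (auto simp: row_length_eq is_partition_def)
  then have "col (row_length l) 0 = length l" by (rule less_iff_eqI)
  then show ?thesis by (intro nth_equalityI) (auto simp: list_of_def row_length_eq)
qed

lemma sum_list_of:
  assumes "p \<in> seqs N"
  shows "sum_list (list_of p) = (\<Sum>i<N. p i)"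
proof -
  have "col p 0 \<le> N" using less_col_iff[OF assms, of N 0] seqs_zero[OF assms, of N] by simp
  moreover have "p i = 0" if "\<not> i < col p 0" for i using that less_col_iff[OF assms, of i 0] by simp
  ultimately have "(\<Sum>i<N. p i) = (\<Sum>i<col p 0. p i)"
    by (intro sum.mono_neutral_right) auto
  then show ?thesis by (simp add: list_of_def sum_list_distinct_conv_sum_set atLeast0LessThan)
qed

lemma glue_seqs:
  assumes "(e, a, b) \<in> dissections L"
  shows "glue L (e, a, b) \<in> seqs (e + a 0)"
proof -
  have a: "a \<in> seqs (e + L)" and b: "b \<in> seqs e" using assms by (auto simp: dissections_def)
  have c0: "col a k \<le> e + L" for k
    using less_col_iff[OF a, of "e + L" k] seqs_zero[OF a, of "e + L"] by simp
  show ?thesis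
  proof (rule seqsI)
    fix i
    show "glue L (e, a, b) (Suc i) \<le> glue L (e, a, b) i"
      using seqs_antimono[OF b, of i "Suc i"] c0[of 0] c0[of "Suc i - e"]
        seqs_antimono[OF col_seqs[OF a], of "i - e" "Suc i - e"]
      by (auto simp: glue_def)
    assume "e + a 0 \<le> i"
    then show "glue L (e, a, b) i = 0" using seqs_zero[OF col_seqs[OF a], of "i - e"] by (simp add: glue_def)
  qed
qed

lemma sum_list_glue:
  assumes "(e, a, b) \<in> dissections L"
  shows "sum_list (list_of (glue L (e, a, b))) = dsize L (e, a, b)"
proof -
  have a: "a \<in> seqs (e + L)" and b: "b \<in> seqs e" using assms by (auto simp: dissections_def)
  have "sum_list (list_of (glue L (e, a, b))) = (\<Sum>i<e + a 0. glue L (e, a, b) i)"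
    by (rule sum_list_of[OF glue_seqs[OF assms]])
  also have "\<dots> = (\<Sum>i<e. glue L (e, a, b) i) + (\<Sum>i<a 0. glue L (e, a, b) (e + i))"
    by (subst sum_lessThan_split_at[of e]) auto
  also have "\<dots> = (\<Sum>i<e. e + L + b i) + (\<Sum>i<a 0. col a i)"
    by (simp add: glue_def)
  also have "(\<Sum>i<a 0. col a i) = (\<Sum>i<e+L. a i)" by (rule sum_col[OF a]) simp
  finally show ?thesis by (simp add: dsize_def sum.distrib)
qed

lemma dissect_least:
  fixes L :: nat
  assumes "is_partition l"
  defines "e \<equiv> LEAST e. row_length l e \<le> e + L"
  shows "row_length l e \<le> e + L" "i < e \<Longrightarrow> e + L \<le> row_length l i"
proof -
  have "row_length l (length l) \<le> length l + L" by (simp add: row_length_eq)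
  then show "row_length l e \<le> e + L" unfolding e_def by (rule LeastI)
  assume i: "i < e"
  then have "\<not> row_length l (e - 1) \<le> e - 1 + L"
    using not_less_Least[of "e - 1" "\<lambda>e. row_length l e \<le> e + L"] by (simp add: e_def)
  then show "e + L \<le> row_length l i" using i seqs_antimono[OF row_length_seqs[OF assms(1)], of i "e - 1"] by linarith
qed

lemma dissect_props:
  assumes l: "is_partition l"
  shows "dissect L l \<in> dissections L" "list_of (glue L (dissect L l)) = l"
proof -
  define e where "e = (LEAST e. row_length l e \<le> e + L)"
  define a where "a = (\<lambda>j. if j < e + L then col (row_length l) j - e else 0)"
  define b where "b = (\<lambda>i. if i < e then row_length l i - (e + L) else 0)"
  have d: "dissect L l = (e, a, b)"
    unfolding dissect_def Let_def e_def[symmetric] a_def b_def ..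
  note p = row_length_seqs[OF l] and e = dissect_least[OF l, where L = L, folded e_def]
  have a: "a \<in> seqs (e + L)"
    using seqs_antimono[OF col_seqs[OF p]] by (intro seqsI) (auto simp: a_def intro!: diff_le_mono)
  have b: "b \<in> seqs e"
    using seqs_antimono[OF p] by (intro seqsI) (auto simp: b_def intro!: diff_le_mono)
  show D: "dissect L l \<in> dissections L" using a b by (simp add: d dissections_def)
  have "glue L (e, a, b) i = row_length l i" for i
  proof (cases "i < e")
    case True then show ?thesis using e(2)[OF True] by (simp add: glue_def b_def)
  next
    case False
    \<comment> \<open>Below the rectangle rows have at most \<open>e + L\<close> cells, so the
      cutoff in \<open>a\<close> loses none of them.\<close>
    have "j < col a (i - e) \<longleftrightarrow> j < row_length l i" for j
    proof -
      have "j < col a (i - e) \<longleftrightarrow> j < e + L \<and> i < col (row_length l) j"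
        using False unfolding less_col_iff[OF a] by (auto simp: a_def)
      also have "\<dots> \<longleftrightarrow> j < row_length l i"
        using seqs_antimono[OF p, of e i] False e(1) unfolding less_col_iff[OF p] by auto
      finally show ?thesis .
    qed
    then show ?thesis using False by (auto simp: glue_def intro: less_iff_eqI)
  qed
  then have "glue L (e, a, b) = row_length l" ..
  then show "list_of (glue L (dissect L l)) = l" by (simp add: d list_of_rows[OF l])
qed

lemma dissect_list_of_glue:
  assumes "(e, a, b) \<in> dissections L"
  shows "dissect L (list_of (glue L (e, a, b))) = (e, a, b)"
proof -
  have a: "a \<in> seqs (e + L)" and b: "b \<in> seqs e" using assms by (auto simp: dissections_def)
  define p where "p = glue L (e, a, b)"
  note p = glue_seqs[OF assms, folded p_def]
  have p1: "p i = e + L + b i" if "i < e" for i using that by (simp add: p_def glue_def)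
  have p2: "p i = col a (i - e)" if "e \<le> i" for i using that by (simp add: p_def glue_def)
  have "p e \<le> e + L"
    using less_col_iff[OF a, of "e + L" 0] seqs_zero[OF a, of "e + L"] p2[of e] by simp
  then have e: "(LEAST e. p e \<le> e + L) = e"
  proof (rule Least_equality)
    show "e \<le> y" if "p y \<le> y + L" for y using that p1[of y] by (cases "y < e") auto
  qed
  have "col p j = e + a j" if "j < e + L" for j
  proof (rule less_iff_eqI)
    fix i show "i < col p j \<longleftrightarrow> i < e + a j"
      unfolding less_col_iff[OF p] using that p1[of i] p2[of i] less_col_iff[OF a, of j "i - e"]
      by (cases "i < e") auto
  qed
  then have "(\<lambda>j. if j < e + L then col p j - e else 0) = a"
    using seqs_zero[OF a] by (auto simp: fun_eq_iff)
  moreover have "(\<lambda>i. if i < e then p i - (e + L) else 0) = b"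
    using p1 seqs_zero[OF b] by (auto simp: fun_eq_iff)
  ultimately show ?thesis
    unfolding p_def[symmetric] dissect_def row_length_list_of[OF p] e Let_def by simp
qed

lemma bij_dissect: "bij_betw (dissect L) {l. is_partition l} (dissections L)"
proof (rule bij_betw_byWitness[where f' = "\<lambda>x. list_of (glue L x)"])
  show "\<forall>l\<in>{l. is_partition l}. list_of (glue L (dissect L l)) = l" by (simp add: dissect_props)
  show "\<forall>x\<in>dissections L. dissect L (list_of (glue L x)) = x" using dissect_list_of_glue by fast
  show "dissect L ` {l. is_partition l} \<subseteq> dissections L" by (auto intro: dissect_props)
  show "(\<lambda>x. list_of (glue L x)) ` dissections L \<subseteq> {l. is_partition l}"
    using is_partition_list_of glue_seqs by fast
qed

lemma dsize_dissect:
  assumes "is_partition l"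
  shows "dsize L (dissect L l) = sum_list l"
proof -
  obtain e a b where d: "dissect L l = (e, a, b)" by (cases "dissect L l")
  show ?thesis
    using sum_list_glue[of e a b L] dissect_props[OF assms, of L] by (simp add: d)
qed

section \<open>Conjugates, Durfee squares and successive ranks\<close>

lemma row_length_conjugate:
  assumes "is_partition l"
  shows "row_length (conjugate l) j = col (row_length l) j"
proof -
  have Y: "{i. (i, Suc j) \<in> young_diagram l} = Suc ` {i. j < row_length l i}" for j
  proof (intro set_eqI iffI)
    fix i assume "i \<in> {i. (i, Suc j) \<in> young_diagram l}"
    then show "i \<in> Suc ` {i. j < row_length l i}" by (cases i) (auto simp: young_diagram_def row_length_def)
  qed (auto simp: young_diagram_def row_length_def)
  have "conjugate l = map (\<lambda>j. card {i. (i, j) \<in> young_diagram l}) (map Suc [0..<row_length l 0])"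
    unfolding conjugate_def row_length_def by (simp add: map_Suc_upt)
  then have "conjugate l = map (\<lambda>j. card {i. (i, Suc j) \<in> young_diagram l}) [0..<row_length l 0]" by simp
  also have "\<dots> = map (col (row_length l)) [0..<row_length l 0]" unfolding Y col_def by (simp add: card_image)
  finally have c: "conjugate l = map (col (row_length l)) [0..<row_length l 0]" .
  show ?thesis
    unfolding c using seqs_zero[OF col_seqs[OF row_length_seqs[OF assms]], of j]
    by (subst row_length_eq) simp
qed

text \<open>The rows before the first one that misses the diagonal contain the square, while a
  larger square would contain the missing diagonal cell \<open>(Suc e, Suc e)\<close>.\<close>

lemma durfee_eq:
  assumes "is_partition l"
  shows "durfee l = (LEAST e. row_length l e \<le> e)"
proof -
  define e where "e = (LEAST e. row_length l e \<le> e)"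
  note e = dissect_least[OF assms, where L = 0, simplified, folded e_def]
  have Y: "(Suc i, Suc j) \<in> young_diagram l \<longleftrightarrow> j < row_length l i" for i j
    by (auto simp: young_diagram_def row_length_def)
  have "durfee l = e"
    unfolding durfee_def
  proof (rule Greatest_equality)
    show "{1..e} \<times> {1..e} \<subseteq> young_diagram l"
    proof clarify
      fix i j assume "i \<in> {1..e}" "j \<in> {1..e}"
      then have "i - 1 < e" "j - 1 < e" "Suc (i - 1) = i" "Suc (j - 1) = j" by auto
      with Y[of "i - 1" "j - 1"] e(2)[of "i - 1"] show "(i, j) \<in> young_diagram l" by simp
    qed
    show "d \<le> e" if "{1..d} \<times> {1..d} \<subseteq> young_diagram l" for d
    proof (rule ccontr)
      assume "\<not> d \<le> e"
      then have "(Suc e, Suc e) \<in> young_diagram l" using that by auto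
      then show False using Y[of e e] e(1) by simp
    qed
  qed
  then show ?thesis by (simp add: e_def)
qed

lemma dissect_0:
  assumes "is_partition l"
  shows "dissect 0 l = (durfee l, \<lambda>i. if i < durfee l then beta l (Suc i) else 0,
                                  \<lambda>i. if i < durfee l then alpha l (Suc i) else 0)"
  unfolding dissect_def alpha_def beta_def row_length_def[symmetric] row_length_conjugate[OF assms]
    durfee_eq[OF assms] Let_def add_0_right ..

text \<open>For \<open>i < d\<close>, row \<open>i\<close> and column \<open>i\<close> both have
  length at least \<open>d\<close>, so comparing lengths is comparing the excesses over
  \<open>d\<close>; from \<open>d\<close> on both sequences are 0.\<close>

lemma P_plus_iff: "l \<in> P_plus \<longleftrightarrow> is_partition l \<and> dissect 0 l \<in> nested 0"
proof (cases "is_partition l")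
  case True
  note p = row_length_seqs[OF True]
  define d where "d = durfee l"
  have d1: "d \<le> row_length l i" if "i < d" for i
    using dissect_least(2)[OF True, of i 0] that by (simp add: durfee_eq[OF True] d_def)
  have d2: "d \<le> col (row_length l) i" if "i < d" for i
  proof -
    have "i < row_length l (d - 1)" using d1[of "d - 1"] that by simp
    then have "d - 1 < col (row_length l) i" by (simp add: less_col_iff[OF p])
    then show ?thesis by simp
  qed
  have "l \<in> P_plus \<longleftrightarrow> (\<forall>i<d. 0 \<le> successive_rank l (Suc i))"
  proof -
    have "(\<forall>i. 1 \<le> i \<and> i \<le> d \<longrightarrow> Q i) \<longleftrightarrow> (\<forall>i<d. Q (Suc i))" for Q
      by (metis One_nat_def Suc_le_eq Suc_pred not_less_eq_eq le0 less_Suc_eq_le)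
    then show ?thesis using True by (simp add: P_plus_def d_def)
  qed
  also have "\<dots> \<longleftrightarrow> (\<forall>i<d. col (row_length l) i \<le> row_length l i)"
    by (simp add: successive_rank_def row_length_def[symmetric] row_length_conjugate[OF True])
  also have "\<dots> \<longleftrightarrow> (\<forall>i<d. beta l (Suc i) \<le> alpha l (Suc i))"
    unfolding alpha_def beta_def row_length_def[symmetric] row_length_conjugate[OF True] d_def[symmetric]
    using d1 d2 by (auto simp: le_diff_iff)
  also have "\<dots> \<longleftrightarrow> dissect 0 l \<in> nested 0"
    using dissect_props(1)[OF True, of 0] by (auto simp: nested_def dissect_0[OF True] d_def)
  finally show ?thesis using True by simp
qed (simp add: P_plus_def)

section \<open>Counting diagonal blocks\<close>

text \<open>On \<open>S\<close>, \<open>h\<close> is a complete invariant of the classes, so it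
  descends to a bijection from the quotient onto its values.\<close>

lemma card_quotient_eq:
  assumes "sym R" "\<And>x y. x \<in> S \<Longrightarrow> y \<in> S \<Longrightarrow> h x = h y \<longleftrightarrow> (x, y) \<in> R\<^sup>*"
  shows "card (S // R\<^sup>*) = card (h ` S)"
proof -
  have s: "sym (R\<^sup>*)" by (rule sym_rtrancl[OF assms(1)])
  have eq: "R\<^sup>* `` {x} = R\<^sup>* `` {y} \<longleftrightarrow> h x = h y" if "x \<in> S" "y \<in> S" for x y
    unfolding assms(2)[OF that] using s by (auto dest: symD intro: rtrancl_trans)
  define g where "g X = h (SOME x. x \<in> S \<and> X = R\<^sup>* `` {x})" for X
  have g: "g (R\<^sup>* `` {x}) = h x" if "x \<in> S" for x
  proof -
    have "\<exists>y. y \<in> S \<and> R\<^sup>* `` {x} = R\<^sup>* `` {y}" using that by blast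
    from someI_ex[OF this] show ?thesis unfolding g_def using eq[OF that] by metis
  qed
  have "bij_betw g (S // R\<^sup>*) (h ` S)"
    unfolding bij_betw_def inj_on_def by (auto simp: quotient_def g eq image_iff)
  then show ?thesis by (rule bij_betw_same_card)
qed

text \<open>Each row is connected, and a nonempty row touches the previous one exactly when it is
  not a head. So the component of a cell is identified by the last head up to its row.\<close>

lemma card_edge_components_skew:
  assumes a: "antimono a" and b: "antimono b" and ab: "\<And>i. a i \<le> b i"
  shows "card (edge_components {(Suc i, j) |i j. a i < j \<and> j \<le> b i}) = card (heads 0 a b)"
proof -
  define S where "S = {(Suc i, j) |i j. a i < j \<and> j \<le> b i}"
  define R where "R = {(c, c'). c \<in> S \<and> c' \<in> S \<and> edge_adjacent c c'}"
  define head where "head i = Max {f \<in> heads 0 a b. f \<le> i}" for i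
  have fin: "finite {f \<in> heads 0 a b. f \<le> i}" for i by (rule finite_subset[of _ "{..i}"]) auto
  have S: "(Suc i, j) \<in> S \<longleftrightarrow> a i < j \<and> j \<le> b i" for i j by (auto simp: S_def)
  have "sym R" by (auto simp: R_def sym_def edge_adjacent_def)
  then have sR: "sym (R\<^sup>*)" by (rule sym_rtrancl)
  have head_eq: "head i = i" if "i \<in> heads 0 a b" for i
    unfolding head_def by (rule Max_eqI) (use fin that in auto)
  have head_Suc: "head (Suc i) = head i" if "Suc i \<notin> heads 0 a b" for i
  proof -
    have "{f \<in> heads 0 a b. f \<le> Suc i} = {f \<in> heads 0 a b. f \<le> i}" using that by (auto simp: le_Suc_eq)
    then show ?thesis by (simp add: head_def)
  qed
  have row: "((Suc i, j), (Suc i, b i)) \<in> R\<^sup>*" if "a i < j" "j \<le> b i" for i j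
    using that(2)
  proof (induction rule: inc_induct)
    case (step n)
    then have "((Suc i, n), (Suc i, Suc n)) \<in> R"
      using that by (auto simp: R_def S edge_adjacent_def)
    then show ?case using step.IH by (rule converse_rtrancl_into_rtrancl)
  qed simp
  \<comment> \<open>Climb row by row: if the nonempty row \<open>Suc i\<close> is not a head, then
    \<open>a i < b (Suc i) <= b i\<close>, so the cell above its last cell belongs to
    \<open>S\<close>.\<close>
  have up: "head i \<in> heads 0 a b \<and> ((Suc i, b i), (Suc (head i), b (head i))) \<in> R\<^sup>*" if "a i < b i" for i
    using that
  proof (induction i)
    case 0
    then have "0 \<in> heads 0 a b" by (simp add: heads_def)
    then show ?case by (simp add: head_eq)
  next
    case (Suc i)
    show ?case
    proof (cases "Suc i \<in> heads 0 a b")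
      case True then show ?thesis by (simp add: head_eq)
    next
      case False
      then have l: "a i < b (Suc i)" using Suc.prems by (simp add: heads_def)
      have "b (Suc i) \<le> b i" using b by (simp add: antimono_def)
      then have "((Suc (Suc i), b (Suc i)), (Suc i, b (Suc i))) \<in> R"
        using l Suc.prems by (simp add: R_def S edge_adjacent_def)
      moreover have "((Suc i, b (Suc i)), (Suc i, b i)) \<in> R\<^sup>*"
        using l \<open>b (Suc i) \<le> b i\<close> by (rule row)
      moreover have "head i \<in> heads 0 a b \<and> ((Suc i, b i), (Suc (head i), b (head i))) \<in> R\<^sup>*"
        using l \<open>b (Suc i) \<le> b i\<close> by (intro Suc.IH) simp
      ultimately show ?thesis using head_Suc[OF False]
        by (auto intro: converse_rtrancl_into_rtrancl rtrancl_trans)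
    qed
  qed
  define h where "h c = head (fst c - 1)" for c :: "nat \<times> nat"
  have to_head: "(c, (Suc (h c), b (h c))) \<in> R\<^sup>*" "h c \<in> heads 0 a b" if cS: "c \<in> S" for c
  proof -
    obtain i j where c: "c = (Suc i, j)" "a i < j" "j \<le> b i" using cS by (auto simp: S_def)
    with row[of i j] up[of i] show "(c, (Suc (h c), b (h c))) \<in> R\<^sup>*" "h c \<in> heads 0 a b"
      by (auto simp: h_def intro: rtrancl_trans)
  qed
  \<comment> \<open>A common column \<open>j\<close> gives \<open>a i < j <= b (Suc i)\<close>;
    hence vertical steps preserve the head.\<close>
  have no_head: "Suc i \<notin> heads 0 a b" if "(Suc i, j) \<in> S" "(Suc (Suc i), j) \<in> S" for i j
    using that by (auto simp: S heads_def)
  have step: "h c = h c'" if cR: "(c, c') \<in> R" for c c'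
  proof -
    obtain i j i' j' where c: "c = (Suc i, j)" "c' = (Suc i', j')" "c \<in> S" "c' \<in> S" "edge_adjacent c c'"
      using cR by (auto simp: R_def S_def)
    then consider "i = i'" | "i' = Suc i" "j = j'" | "i = Suc i'" "j = j'"
      by (auto simp: edge_adjacent_def)
    then show ?thesis
      using c no_head by cases (auto simp: h_def head_Suc)
  qed
  have const: "h c = h c'" if "(c, c') \<in> R\<^sup>*" for c c'
    using that by (induction rule: rtrancl_induct) (auto dest: step)
  have "card (S // R\<^sup>*) = card (h ` S)"
  proof (rule card_quotient_eq[OF \<open>sym R\<close>])
    fix x y assume "x \<in> S" "y \<in> S"
    then show "h x = h y \<longleftrightarrow> (x, y) \<in> R\<^sup>*"
      using to_head(1)[of x] to_head(1)[of y] const[of x y] sR by (metis rtrancl_trans symD)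
  qed
  also have "h ` S = heads 0 a b"
  proof
    show "h ` S \<subseteq> heads 0 a b" using to_head by auto
    show "heads 0 a b \<subseteq> h ` S"
    proof
      fix i assume i: "i \<in> heads 0 a b"
      then have "(Suc i, b i) \<in> S" by (simp add: S heads_def)
      moreover have "h (Suc i, b i) = i" using i by (simp add: h_def head_eq)
      ultimately show "i \<in> h ` S" by (metis imageI)
    qed
  qed
  finally show ?thesis by (simp add: edge_components_def S_def R_def)
qed

text \<open>For a nested pair the minimum is \<open>a\<close> and the maximum is \<open>b\<close>.
  Both vanish from \<open>durfee l\<close> on, so the rows without the bound on \<open>i\<close>
  contribute no further cells.\<close>

lemma kappa_eq:
  assumes "l \<in> P_plus" "dissect 0 l = (e, a, b)"
  shows "kappa l = card (heads 0 a b)"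
proof -
  have l: "is_partition l" and n: "(e, a, b) \<in> nested 0" using assms by (auto simp: P_plus_iff)
  note d = dissect_0[OF l, unfolded assms(2)]
  have ab: "a i \<le> b i" for i using n by (simp add: nested_def)
  have "antimono a" "antimono b" using n by (auto simp: nested_def dissections_def seqs_def)
  moreover have "skew_cells l = {(Suc i, j) |i j. a i < j \<and> j \<le> b i}"
  proof (intro set_eqI iffI)
    fix c assume "c \<in> skew_cells l"
    then obtain i j where c: "c = (i, j)" "1 \<le> i" "i \<le> durfee l" "inner_part l i < j" "j \<le> outer_part l i"
      by (auto simp: skew_cells_def)
    obtain k where k: "i = Suc k" using c(2) by (cases i) auto
    show "c \<in> {(Suc i, j) |i j. a i < j \<and> j \<le> b i}"
      using c ab[of k] d k by (auto simp: inner_part_def outer_part_def)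
  next
    fix c assume "c \<in> {(Suc i, j) |i j. a i < j \<and> j \<le> b i}"
    then obtain i j where c: "c = (Suc i, j)" "a i < j" "j \<le> b i" by auto
    then show "c \<in> skew_cells l"
      using ab[of i] d by (auto simp: skew_cells_def inner_part_def outer_part_def split: if_splits)
  qed
  ultimately show ?thesis
    unfolding kappa_def diagonal_blocks_def using card_edge_components_skew[of a b] ab by simp
qed

section \<open>Counting by size\<close>

text \<open>Weights are integers so that \<open>N - c\<close> may become negative; for the sizes
  used below the fibre is then empty and no case distinction arises.\<close>

lemma card_fiber_bij:
  assumes "bij_betw f A B" "\<And>x. x \<in> A \<Longrightarrow> w x = w' (f x) + (c :: int)"
  shows "card {x \<in> A. w x = N} = card {y \<in> B. w' y = N - c}"
proof -
  have "bij_betw f {x \<in> A. w x = N} {y \<in> B. w' y = N - c}"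
    using assms by (fastforce simp: bij_betw_def inj_on_def image_iff)
  then show ?thesis by (rule bij_betw_same_card)
qed

lemma finite_partitions_of_int: "finite {l. is_partition l \<and> int (sum_list l) = N}"
  by (rule finite_subset[OF _ finite_partitions_of[of "nat N"]]) auto

lemma bij_dissect_fiber:
  "bij_betw (dissect L) {l. is_partition l \<and> int (sum_list l) = N}
     {x \<in> dissections L. int (dsize L x) = N}"
  using bij_dissect[of L] dsize_dissect[of _ L] by (fastforce simp: bij_betw_def inj_on_def image_iff)

lemma card_dissections: "card {x \<in> dissections L. int (dsize L x) = N} = partition_number N"
  unfolding partition_number_def by (rule bij_betw_same_card[OF bij_dissect_fiber, symmetric])

lemma finite_dissections: "finite {x \<in> dissections L. int (dsize L x) = N}"
  using bij_betw_finite[OF bij_dissect_fiber] finite_partitions_of_int by blast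

lemma card_nested:
  "int (card {x \<in> nested L. int (dsize L x) = N})
     = int (partition_number N) - int (partition_number (N - (2 * int L + 2)))"
proof -
  have "card {x \<in> dissections L - nested L. int (dsize L x) = N}
      = card {y \<in> dissections (L + 2). int (dsize (L + 2) y) = N - (2 * int L + 2)}"
  proof (rule card_fiber_bij[OF bij_swap])
    fix x assume "x \<in> dissections L - nested L"
    then show "int (dsize L x) = int (dsize (L + 2) (swap L x)) + (2 * int L + 2)"
      using swap_not_nested(3)[of "fst x" "fst (snd x)" "snd (snd x)" L] by simp
  qed
  then have 1: "card {x \<in> dissections L - nested L. int (dsize L x) = N}
      = partition_number (N - (2 * int L + 2))"
    by (simp add: card_dissections)
  have "{x \<in> dissections L. int (dsize L x) = N}
      = {x \<in> nested L. int (dsize L x) = N} \<union> {x \<in> dissections L - nested L. int (dsize L x) = N}"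
    by (auto simp: nested_def)
  moreover have "card ({x \<in> nested L. int (dsize L x) = N} \<union> {x \<in> dissections L - nested L. int (dsize L x) = N})
      = card {x \<in> nested L. int (dsize L x) = N} + card {x \<in> dissections L - nested L. int (dsize L x) = N}"
    by (rule card_Un_disjoint) (auto intro: finite_subset[OF _ finite_dissections[of L N]] simp: nested_def)
  ultimately show ?thesis using 1 card_dissections[of L N] by simp
qed

text \<open>From level \<open>L\<close>, \<open>m\<close> moves lose
  \<open>2 * (L + 2 * k) + 2\<close> cells for each \<open>k < m\<close>, that is
  \<open>2 * L * m + 2 * m^2\<close> in total. The nested pairs at level \<open>L + 2 * m\<close>
  then subtract the partitions of a number smaller by \<open>2 * (L + 2 * m) + 2\<close>, which
  gives the second argument. The induction changes both \<open>L\<close> and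
  \<open>N\<close>.\<close>

lemma card_marked:
  "int (card {y \<in> marked L m. int (dsize L (fst y)) = N})
     = int (partition_number (N - (2 * int L * int m + 2 * (int m)\<^sup>2)))
       - int (partition_number (N - (2 * int L * (int m + 1) + 2 * (int m + 1)\<^sup>2)))"
proof (induction m arbitrary: L N)
  case 0
  \<comment> \<open>Infinite sets also have \<open>card\<close> 0; the finiteness of
    \<open>heads\<close> is what forces \<open>C\<close> to be empty.\<close>
  have "marked L 0 = (\<lambda>x. (x, {})) ` nested L"
  proof (intro set_eqI iffI)
    fix y assume "y \<in> marked L 0"
    then obtain e a b C where y: "y = ((e, a, b), C)" "(e, a, b) \<in> nested L" "C \<subseteq> heads L a b" "card C = 0"
      by (auto simp: marked_def)
    then have "b \<in> seqs e" by (simp add: nested_def dissections_def)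
    then have "finite C" using y(3) heads_finite(2) finite_subset by blast
    then show "y \<in> (\<lambda>x. (x, {})) ` nested L" using y by auto
  qed (auto simp: marked_def)
  then have "bij_betw (\<lambda>x. (x, {})) (nested L) (marked L 0)" by (simp add: bij_betw_def inj_on_def)
  then have "card {x \<in> nested L. int (dsize L x) = N}
      = card {y \<in> marked L 0. int (dsize L (fst y)) = N - 0}"
    by (rule card_fiber_bij) simp
  then show ?case using card_nested[of L N] by simp
next
  case (Suc m)
  have step: "card {y \<in> marked L (Suc m). int (dsize L (fst y)) = N}
      = card {y \<in> marked (L + 2) m. int (dsize (L + 2) (fst y)) = N - (2 * int L + 2)}"
  proof (rule card_fiber_bij[OF bij_move])
    fix x assume "x \<in> marked L (Suc m)"
    then show "int (dsize L (fst x)) = int (dsize (L + 2) (fst (move L x))) + (2 * int L + 2)"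
      using move_marked(3)[of "fst (fst x)" "fst (snd (fst x))" "snd (snd (fst x))" "snd x" L m] by simp
  qed
  have e1: "N - (2 * int L + 2) - (2 * int (L + 2) * int m + 2 * (int m)\<^sup>2)
      = N - (2 * int L * int (Suc m) + 2 * (int (Suc m))\<^sup>2)"
    by (simp add: algebra_simps power2_eq_square)
  have e2: "N - (2 * int L + 2) - (2 * int (L + 2) * (int m + 1) + 2 * (int m + 1)\<^sup>2)
      = N - (2 * int L * (int (Suc m) + 1) + 2 * (int (Suc m) + 1)\<^sup>2)"
    by (simp add: algebra_simps power2_eq_square)
  show ?case unfolding step Suc.IH e1 e2 ..
qed

text \<open>The binomial coefficient counts the \<open>m\<close>-subsets of the heads, which are as
  many as the diagonal blocks; \<open>dissect 0\<close> carries the sum from partitions to nested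
  pairs.\<close>

lemma sum_kappa_choose:
  "(\<Sum>l\<in>{l \<in> P_plus. sum_list l = n}. kappa l choose m) = card {y \<in> marked 0 m. int (dsize 0 (fst y)) = int n}"
proof -
  define H where "H x = (case x of (e, a, b) \<Rightarrow> heads 0 a b)" for x :: dissection
  let ?A = "{x \<in> nested 0. dsize 0 x = n}"
  have finA: "finite ?A"
    by (rule finite_subset[OF _ finite_dissections[of 0 "int n"]]) (auto simp: nested_def)
  have finH: "finite (H x)" if "x \<in> nested 0" for x
    using that heads_finite(2) by (auto simp: H_def nested_def dissections_def split: prod.splits)
  have "{y \<in> marked 0 m. int (dsize 0 (fst y)) = int n} = (SIGMA x:?A. {C. C \<subseteq> H x \<and> card C = m})"
    by (auto simp: marked_def H_def)
  then have "card {y \<in> marked 0 m. int (dsize 0 (fst y)) = int n} = (\<Sum>x\<in>?A. card {C. C \<subseteq> H x \<and> card C = m})"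
    using finA finH by (simp add: card_SigmaI)
  also have "\<dots> = (\<Sum>x\<in>?A. card (H x) choose m)"
    using finH by (intro sum.cong refl n_subsets) auto
  also have "\<dots> = (\<Sum>l\<in>{l \<in> P_plus. sum_list l = n}. kappa l choose m)"
  proof (rule sum.reindex_bij_betw[symmetric, THEN trans])
    show "bij_betw (dissect 0) {l \<in> P_plus. sum_list l = n} ?A"
    proof (rule bij_betw_subset[OF bij_dissect[of 0]])
      show "dissect 0 ` {l \<in> P_plus. sum_list l = n} = ?A"
      proof
        show "dissect 0 ` {l \<in> P_plus. sum_list l = n} \<subseteq> ?A"
          by (auto simp: P_plus_iff dsize_dissect)
        show "?A \<subseteq> dissect 0 ` {l \<in> P_plus. sum_list l = n}"
        proof
          fix x assume x: "x \<in> ?A"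
          then have "x \<in> dissections 0" by (auto simp: nested_def)
          then obtain l where "is_partition l" "x = dissect 0 l"
            using bij_betw_imp_surj_on[OF bij_dissect[of 0]] by blast
          then show "x \<in> dissect 0 ` {l \<in> P_plus. sum_list l = n}"
            using x by (auto simp: P_plus_iff dsize_dissect)
        qed
      qed
    qed (auto simp: P_plus_iff)
    show "(\<Sum>l\<in>{l \<in> P_plus. sum_list l = n}. card (H (dissect 0 l)) choose m)
        = (\<Sum>l\<in>{l \<in> P_plus. sum_list l = n}. kappa l choose m)"
      by (intro sum.cong refl) (auto simp: H_def kappa_eq split: prod.splits)
  qed
  finally show ?thesis ..
qed

lemma sum_kappa_choose_eq:
  "int (\<Sum>l\<in>{l \<in> P_plus. sum_list l = n}. kappa l choose m)
     = int (partition_number (int n - 2 * (int m)\<^sup>2)) - int (partition_number (int n - 2 * (int m + 1)\<^sup>2))"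
  using card_marked[of 0 m "int n"] by (simp add: sum_kappa_choose)

section \<open>The generating function of partitions\<close>

definition partitions_le :: "nat \<Rightarrow> nat \<Rightarrow> nat list set" where
  "partitions_le k n = {l. is_partition l \<and> (\<forall>x\<in>set l. x \<le> k) \<and> sum_list l = n}"

lemma finite_partitions_le: "finite (partitions_le k n)"
  by (rule finite_subset[OF _ finite_partitions_of[of n]]) (auto simp: partitions_le_def)

text \<open>The first entry is the largest: either it equals \<open>Suc k\<close> and can be
  removed, or all parts are at most \<open>k\<close>.\<close>

lemma card_partitions_le_Suc:
  "card (partitions_le (Suc k) n)
     = card (partitions_le k n) + (if Suc k \<le> n then card (partitions_le (Suc k) (n - Suc k)) else 0)"
proof -
  let ?B = "if Suc k \<le> n then (#) (Suc k) ` partitions_le (Suc k) (n - Suc k) else {}"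
  have mem_Cons: "x # xs \<in> partitions_le k n \<longleftrightarrow> 0 < x \<and> x \<le> k \<and> x \<le> n \<and> xs \<in> partitions_le x (n - x)" for x xs k n
    by (auto simp: partitions_le_def is_partition_def intro: order_trans)
  have "l \<in> partitions_le (Suc k) n \<longleftrightarrow> l \<in> partitions_le k n \<union> ?B" for l
  proof (cases l)
    case Nil then show ?thesis by (auto simp: partitions_le_def)
  next
    case (Cons x xs)
    have "x # xs \<in> ?B \<longleftrightarrow> x = Suc k \<and> Suc k \<le> n \<and> xs \<in> partitions_le (Suc k) (n - Suc k)"
      by auto
    then show ?thesis unfolding Cons Un_iff mem_Cons[of x xs] le_Suc_eq[of x k] by auto
  qed
  then have "partitions_le (Suc k) n = partitions_le k n \<union> ?B" by blast
  moreover have "card (partitions_le k n \<union> ?B) = card (partitions_le k n) + card ?B"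
  proof (rule card_Un_disjoint)
    show "finite (partitions_le k n)" by (rule finite_partitions_le)
    show "finite ?B" using finite_partitions_le[of "Suc k" "n - Suc k"] by simp
    have "Suc k # xs \<notin> partitions_le k n" for xs by (simp add: mem_Cons)
    then show "partitions_le k n \<inter> ?B = {}" by auto
  qed
  moreover have "card ?B = (if Suc k \<le> n then card (partitions_le (Suc k) (n - Suc k)) else 0)"
    by (simp add: card_image)
  ultimately show ?thesis by (simp only:)
qed

lemma partitions_le_0: "partitions_le 0 n = (if n = 0 then {[]} else {})"
proof -
  have "l = []" if "l \<in> partitions_le 0 n" for l
  proof (cases l)
    case (Cons x xs)
    show ?thesis using that unfolding Cons by (auto simp: partitions_le_def is_partition_def)
  qed simp
  moreover have "[] \<in> partitions_le 0 n \<longleftrightarrow> n = 0"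
    by (auto simp: partitions_le_def is_partition_def)
  ultimately show ?thesis by auto
qed

definition partition_fps :: "rat fps" where
  "partition_fps = Abs_fps (\<lambda>n. of_nat (partition_number (int n)))"

lemma prod_partitions_le:
  "(\<Prod>i<k. 1 - fps_X ^ Suc i) * Abs_fps (\<lambda>n. of_nat (card (partitions_le k n))) = (1 :: rat fps)"
proof (induction k)
  case 0
  show ?case by (rule fps_ext) (simp add: partitions_le_0)
next
  case (Suc k)
  \<comment> \<open>The recurrence in terms of generating functions: this factor removes the parts
    equal to \<open>Suc k\<close>.\<close>
  have "(1 - fps_X ^ Suc k) * Abs_fps (\<lambda>n. of_nat (card (partitions_le (Suc k) n)))
      = (Abs_fps (\<lambda>n. of_nat (card (partitions_le k n))) :: rat fps)"
    (is "?l = ?r")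
  proof (rule fps_ext)
    show "fps_nth ?l n = fps_nth ?r n" for n
      using card_partitions_le_Suc[of k n]
      by (simp add: left_diff_distrib fps_X_power_mult_nth del: power_Suc)
  qed
  then show ?case unfolding prod.lessThan_Suc mult.assoc by (rule ssubst) (rule Suc)
qed

lemma partition_fps_nth_le:
  assumes "n \<le> k"
  shows "fps_nth partition_fps n = of_nat (card (partitions_le k n))"
proof -
  have "x \<le> k" if "x \<in> set l" "sum_list l = n" for x l
    using member_le_sum_list[OF that(1)] that(2) assms by simp
  then have "{l. is_partition l \<and> int (sum_list l) = int n} = partitions_le k n"
    unfolding partitions_le_def of_nat_eq_iff by blast
  then show ?thesis by (simp add: partition_fps_def partition_number_def)
qed

lemma partition_fps_0: "fps_nth partition_fps 0 = 1"
  by (simp add: partition_fps_nth_le[of 0 0] partitions_le_0)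

text \<open>The partial product \<open>Q k\<close> is inverse to \<open>F k\<close>, and
  \<open>F k\<close> agrees with \<open>partition_fps\<close> up to degree \<open>k\<close>; hence
  \<open>Q k\<close> agrees with \<open>G\<close> up to that degree.\<close>

lemma q_pochhammer_inf_eq: "q_pochhammer_inf = inverse partition_fps"
proof -
  define Q where "Q k = (\<Prod>i<k. 1 - fps_X ^ Suc i :: rat fps)" for k
  define F where "F k = (Abs_fps (\<lambda>n. of_nat (card (partitions_le k n))) :: rat fps)" for k
  define G where "G = inverse partition_fps"
  have GP: "G * partition_fps = 1" unfolding G_def by (rule inverse_mult_eq_1) (simp add: partition_fps_0)
  \<comment> \<open>The usual difference of two reciprocals; its last factor has no terms up to
    degree \<open>k\<close>.\<close>
  have "Q k = G + G * Q k * (partition_fps - F k)" for k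
  proof -
    have "Q k * F k = 1" unfolding Q_def F_def by (rule prod_partitions_le)
    then have "G * Q k * (partition_fps - F k) = Q k * (G * partition_fps) - G"
      by (simp add: algebra_simps)
    then show ?thesis by (simp add: GP)
  qed
  moreover have "fps_nth (G * Q k * (partition_fps - F k)) n = 0" if "n \<le> k" for n k
    unfolding fps_mult_nth[of "G * Q k"] using that
    by (intro sum.neutral) (simp add: F_def partition_fps_nth_le[of _ k])
  ultimately have Q_nth: "fps_nth (Q k) n = fps_nth G n" if "n \<le> k" for n k
    using that by (metis add.right_neutral fps_add_nth)
  \<comment> \<open>Power series converge when each coefficient is eventually constant. The partial
    products of \<open>has_prod\<close> include the index \<open>k\<close>, hence
    \<open>Q (Suc k)\<close>, and their limit must be nonzero.\<close>
  have "(\<lambda>k. \<Prod>i\<le>k. 1 - fps_X ^ Suc i) \<longlonglongrightarrow> G"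
    unfolding tendsto_fps_iff lessThan_Suc_atMost[symmetric] Q_def[symmetric]
  proof
    fix n
    show "\<forall>\<^sub>F k in sequentially. fps_nth (Q (Suc k)) n = fps_nth G n"
      using eventually_ge_at_top[of n] by eventually_elim (simp add: Q_nth)
  qed
  moreover have "G \<noteq> 0" using GP by auto
  ultimately have "(\<lambda>j. 1 - fps_X ^ Suc j) has_prod G"
    by (simp add: has_prod_def raw_has_prod_def)
  then show ?thesis
    unfolding q_pochhammer_inf_def G_def by (rule has_prod_unique[symmetric])
qed

lemma fps_nth_X_power_partition_fps:
  "fps_nth (fps_X ^ c * partition_fps) n = of_nat (partition_number (int n - int c))"
proof (cases "c \<le> n")
  case False
  then have "{l. is_partition l \<and> int (sum_list l) = int n - int c} = {}" by auto
  then show ?thesis using False by (simp add: fps_X_power_mult_nth partition_number_def)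
qed (simp add: fps_X_power_mult_nth partition_fps_def of_nat_diff)

text \<open>A net of finite sums converges when each coefficient is eventually constant; coefficient
  \<open>n\<close> is final once all partitions of \<open>n\<close> in \<open>P_plus\<close> are
  included.\<close>

lemma has_sum_kappa_choose:
  "((\<lambda>l. of_nat (kappa l choose m) * fps_X ^ sum_list l) has_sum
     ((fps_X ^ (2 * m\<^sup>2) - fps_X ^ (2 * (m + 1)\<^sup>2)) / q_pochhammer_inf)) P_plus"
  (is "(?f has_sum ?S) _")
proof -
  have S: "?S = fps_X ^ (2 * m\<^sup>2) * partition_fps - fps_X ^ (2 * (m + 1)\<^sup>2) * partition_fps"
    using partition_fps_0 unfolding q_pochhammer_inf_eq
    by (simp add: fps_divide_unit fps_inverse_idempotent left_diff_distrib)
  have "\<forall>\<^sub>F F in finite_subsets_at_top P_plus. fps_nth (sum ?f F) n = fps_nth ?S n" for n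
  proof -
    let ?A = "{l \<in> P_plus. sum_list l = n}"
    have finA: "finite ?A"
      by (rule finite_subset[OF _ finite_partitions_of[of n]]) (auto simp: P_plus_def)
    have "fps_nth (sum ?f F) n = fps_nth ?S n" if F: "finite F" "?A \<subseteq> F" "F \<subseteq> P_plus" for F
    proof -
      have "fps_nth (?f l) n = (if sum_list l = n then of_nat (kappa l choose m) else 0)" for l
        by (simp add: fps_of_nat[symmetric])
      then have "fps_nth (sum ?f F) n = (\<Sum>l\<in>F. if sum_list l = n then of_nat (kappa l choose m) else 0)"
        by (simp add: fps_sum_nth)
      also have "\<dots> = (\<Sum>l\<in>{l \<in> F. sum_list l = n}. of_nat (kappa l choose m))"
        by (rule sum.inter_filter[symmetric]) (rule F)
      also have "{l \<in> F. sum_list l = n} = ?A" using F by auto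
      also have "(\<Sum>l\<in>?A. of_nat (kappa l choose m)) = (of_int (int (\<Sum>l\<in>?A. kappa l choose m)) :: rat)"
        by simp
      also have "\<dots> = fps_nth ?S n"
        unfolding S sum_kappa_choose_eq fps_sub_nth fps_nth_X_power_partition_fps by (simp add: algebra_simps)
      finally show ?thesis .
    qed
    then show ?thesis
      unfolding eventually_finite_subsets_at_top using finA by (intro exI[of _ ?A]) auto
  qed
  then show ?thesis unfolding has_sum_def tendsto_fps_iff by blast
qed

theorem theorem4p5:
  shows "(\<forall>m::nat.
            ((\<lambda>l. of_nat (kappa l choose m) * fps_X ^ sum_list l) has_sum
              ((fps_X ^ (2 * m\<^sup>2) - fps_X ^ (2 * (m + 1)\<^sup>2)) / q_pochhammer_inf)) P_plus)
       \<and> (\<forall>(n::nat) (m::nat).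
            int (\<Sum>l\<in>{l \<in> P_plus. sum_list l = n}. kappa l choose m)
              = int (partition_number (int n - 2 * (int m)\<^sup>2))
                - int (partition_number (int n - 2 * (int m + 1)\<^sup>2)))"
  using has_sum_kappa_choose sum_kappa_choose_eq by blast

end
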